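(* Consider the setting and notation of the context. For a subset $S\subseteq\{1,\dots,p\}$, consider the conditions: (A1) there exists $\dot\zeta:\mathcal F\to L_2(P_0)$ such that $\zeta(f,P)=P[\dot\zeta(f)]$ and such that $f\mapsto\dot\zeta(f)$ is continuous at $f_{0,-S}$ (from $\|\cdot\|_{\mathcal F}$ to $L_2(P_0)$); moreover there exist $C,\delta\in(0,\infty)$ such that for all $f\in\mathcal F_{-S}$ with $\|f-f_{0,-S}\|_{\mathcal F}<\delta$, $|P_0[\dot\zeta(f)-\dot\zeta(f_{0,-S})]|\le C\|f-f_{0,-S}\|_{\mathcal F}^2$; (A2) $P\mapsto\eta(P)$ is pathwise differentiable at $P_0$ relative to a nonparametric model with nonparametric efficient influence function $\phi_0\in L_2^0(P_0)$ at $P_0$; (A3) $U$ is differentiable at $(\zeta(f_{0,-S},P_0),\eta_0)$, with partial derivatives $\dot U_\zeta:=\partial U/\partial\zeta$ and $\dot U_\eta:=\partial U/\partial\eta$; (B1) $\|f_{n,-S}-f_{0,-S}\|_{\mathcal F}=o_{P_0}(n^{-1/4})$; (B2) there exists a $P_0$-Donsker class $\mathcal G$ such that $P_0(\dot\zeta(f_{n,-S})\in\mathcal G)\to1$; (B3) $\eta_n=\eta_0+\mathbb P_n\phi_0+o_{P_0}(n^{-1/2})$. Write $$\dot V_0(f_{0,-S}):=\dot U_\zeta(\zeta(f_{0,-S},P_0),\eta_0)\left[\dot\zeta(f_{0,-S})-P_0\dot\zeta(f_{0,-S})\right]+\dot U_\eta(\zeta(f_{0,-S},P_0),\eta_0)\,\phi_0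 .$$ (i) If the selection algorithm $S_n$ is asymptotically stable with limiting selection set $\mathcal S_0$ and (A1)--(A3) and (B1)--(B3) hold for all $S\in\mathcal S_0$, then for all $S\in\mathcal S_0$, $$V_{n,-S_n}=V(f_{0,-S},P_0)+\mathbb P_n\dot V_0(f_{0,-S})+o_{P_0}(n^{-1/2}).$$ (ii) If the ranking algorithm $R_n$ is asymptotically stable with limiting rank set $\mathcal R_0$ and (A1)--(A3) and (B1)--(B3) hold for all $S=R_{[j]}$ with $R\in\mathcal R_0$ and $j\in\{1,\dots,p\}$, then for all $R\in\mathcal R_0$ and all $j\in\{1,\dots,p\}$, $$V_{n,-R_{n,[j]}}=V(f_{0,-R_{[j]}},P_0)+\mathbb P_n\dot V_0(f_{0,-R_{[j]}})+o_{P_0}(n^{-1/2}).$$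
   Context: Data: $n$ i.i.d. observations $(X_i,Y_i)$ from $P_0$ on $\mathcal X\times\mathcal Y$, $\mathcal X\subseteq\mathbb R^p$, $\mathcal Y\subseteq\mathbb R$, with $p$ fixed as $n\to\infty$; $P_0$ lies in a (nonparametric) model $\mathcal M$. $\mathbb P_n$ is the empirical distribution. $Pf:=\int f\,dP$ for a $P$-integrable $f$. $L_2^0(P_0):=\{h\in L_2(P_0):P_0h=0\}$. Predictiveness: $\mathcal F$ is a class of functions $\mathcal X\to\mathbb R$ endowed with a norm $\|\cdot\|_{\mathcal F}$. For $S\subseteq\{1,\dots,p\}$, $\mathcal F_{-S}\subseteq\mathcal F$ is the set of $f\in\mathcal F$ that do not depend on the covariates with indices in $S$. The predictiveness metric $V:\mathcal F\times\mathcal M\to[0,1]$ has the form $V(f,P)=U(\zeta(f,P),\eta(P))$, with $\zeta$ real-valued and linear in $P$, $\eta:\mathcal M\to\mathbb R$, and $U:\mathrm{range}(\zeta)\times\mathrm{range}(\eta)\to\mathbb R$. $f_{0,-S}\in\arg\max_{f\in\mathcal F_{-S}}V(f,P_0)$ is a fixed choice of maximizer; $\eta_0:=\eta(P_0)$. Pathwise differentiability in (A2): for every path $\{P_\varepsilon\}\subseteq\mathcal M$ through $P_0$ that is differentiable in quadratic mean with score $\dot\ell_0$, $\frac{\partial}{\partial\varepsilon}\eta(P_\varepsilon)|_{\varepsilon=0}=P_0(\phi_0\dot\ell_0)$, the tangent space being all of $L_2^0(P_0)$. Estimators: for each $S$, $f_{n,-S}\in\mathcal F_{-S}$ is an estimator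 of $f_{0,-S}$ and $\eta_n$ an estimator of $\eta_0$, both based on the data. $V_{n,-S}:=U(\zeta(f_{n,-S},\mathbb P_n),\eta_n)$, where $\zeta(f,\mathbb P_n)=\mathbb P_n[\dot\zeta(f)]$. Algorithms: a selection algorithm $S_n$ is a data-dependent random subset of $\{1,\dots,p\}$; a ranking algorithm $R_n$ is a data-dependent random permutation of $\{1,\dots,p\}$. For a permutation $R$, $R_{[j]}$ is the set of its first $j$ elements, and $R_{n,[j]}$ is that of $R_n$. $V_{n,-S_n}$ and $V_{n,-R_{n,[j]}}$ denote $V_{n,-S}$ evaluated at the random sets $S=S_n$ and $S=R_{n,[j]}$. Asymptotic stability: $S_n$ is asymptotically stable with limiting selection set $\mathcal S_0$ (a collection of subsets of $\{1,\dots,p\}$) if $P_0(S_n\in\mathcal S_0)\to1$ and $f_{0,-S}=f_{0,-S'}$ for all $S,S'\in\mathcal S_0$. $R_n$ is asymptotically stable with limiting rank set $\mathcal R_0$ (a set of permutations of $\{1,\dots,p\}$) if $P_0(R_n\in\mathcal R_0)\to1$ and $f_{0,-R_{[j]}}=f_{0,-R'_{[j]}}$ for all $R,R'\in\mathcal R_0$ and $j\in\{1,\dots,p\}$. *)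

theory Defs
  imports "HOL-Probability.Probability" "HOL-Combinatorics.Multiset_Permutations"
begin

section \<open>Square-integrable functions and models\<close>

text \<open>Elements of \<open>L\<^sub>2\<close> are actual functions, not equivalence classes, since they
  are also evaluated at the data points.\<close>

definition L2 :: "'z measure \<Rightarrow> ('z \<Rightarrow> real) set" where
  "L2 P = {h \<in> borel_measurable P. integrable P (\<lambda>z. (h z)\<^sup>2)}"

definition L2_zero :: "'z measure \<Rightarrow> ('z \<Rightarrow> real) set" where
  "L2_zero P = {h \<in> L2 P. (LINT z|P. h z) = 0}"

definition L2_dist :: "'z measure \<Rightarrow> ('z \<Rightarrow> real) \<Rightarrow> ('z \<Rightarrow> real) \<Rightarrow> real" where
  "L2_dist P g h = sqrt (LINT z|P. (g z - h z)\<^sup>2)"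

definition statistical_model ::
  "(real ^ 'p) set \<Rightarrow> real set \<Rightarrow> ((real ^ 'p) \<times> real) measure set \<Rightarrow> bool" where
  "statistical_model \<X> \<Y> \<M> \<longleftrightarrow>
     (\<forall>P\<in>\<M>. prob_space P \<and> sets P = sets (restrict_space borel (\<X> \<times> \<Y>)))"


section \<open>Stochastic order, data and empirical means\<close>

text \<open>Estimated functions take values in an arbitrary class and need not be measurable, so
  convergence in probability is taken in outer probability; for measurable \<open>X\<close> this is the usual
  \<open>X n = o\<^sub>P(r n)\<close>.\<close>

definition little_oP :: "'w measure \<Rightarrow> (nat \<Rightarrow> 'w \<Rightarrow> real) \<Rightarrow> (nat \<Rightarrow> real) \<Rightarrow> bool" where
  "little_oP M X r \<longleftrightarrow>
     (\<forall>e>0. (\<lambda>n. outer_measure_of M {\<omega> \<in> space M. \<bar>X n \<omega>\<bar> > e * r n}) \<longlonglongrightarrow> 0)"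

definition sample :: "(nat \<Rightarrow> 'w \<Rightarrow> 'z) \<Rightarrow> nat \<Rightarrow> 'w \<Rightarrow> nat \<Rightarrow> 'z" where
  "sample Z n \<omega> = (\<lambda>i\<in>{..<n}. Z i \<omega>)"

definition emp_mean :: "nat \<Rightarrow> (nat \<Rightarrow> 'z) \<Rightarrow> ('z \<Rightarrow> real) \<Rightarrow> real" where
  "emp_mean n d h = (\<Sum>i<n. h (d i)) / real n"


section \<open>Donsker classes\<close>

text \<open>Weak convergence in the sense of Hoffmann-Jorgensen, of the empirical process in
  \<open>\<ell>\<^sup>\<infinity>(G)\<close>, to a tight Borel law (van der Vaart and Wellner, Section 2.1).\<close>

definition outer_expectation :: "'w measure \<Rightarrow> ('w \<Rightarrow> real) \<Rightarrow> real" where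
  "outer_expectation M T =
     Inf {(LINT \<omega>|M. U \<omega>) | U. integrable M U \<and> (\<forall>\<omega>\<in>space M. T \<omega> \<le> U \<omega>)}"

definition ell_infinity :: "'g set \<Rightarrow> ('g \<Rightarrow> real) metric" where
  "ell_infinity G = funspace G euclidean_metric"

definition tight_borel_law :: "'a metric \<Rightarrow> 'a measure \<Rightarrow> bool" where
  "tight_borel_law D L \<longleftrightarrow>
     prob_space L \<and> space L = mspace D \<and>
     sets L = sigma_sets (mspace D) {U. openin (mtopology_of D) U} \<and>
     (\<forall>e>0. \<exists>K. compactin (mtopology_of D) K \<and> measure L K \<ge> 1 - e)"

definition converges_weakly_to ::
  "'w measure \<Rightarrow> 'a metric \<Rightarrow> (nat \<Rightarrow> 'w \<Rightarrow> 'a) \<Rightarrow> 'a measure \<Rightarrow> bool" where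
  "converges_weakly_to M D X L \<longleftrightarrow>
     (\<forall>h. continuous_map (mtopology_of D) euclideanreal h \<and> bounded (h ` mspace D) \<longrightarrow>
        (\<lambda>n. outer_expectation M (\<lambda>\<omega>. h (X n \<omega>))) \<longlonglongrightarrow> (LINT x|L. h x))"

definition empirical_process ::
  "'z measure \<Rightarrow> ('z \<Rightarrow> real) set \<Rightarrow> nat \<Rightarrow> (nat \<Rightarrow> 'z) \<Rightarrow> (('z \<Rightarrow> real) \<Rightarrow> real)" where
  "empirical_process P G n d = (\<lambda>g\<in>G. sqrt (real n) * (emp_mean n d g - (LINT z|P. g z)))"

text \<open>The boundedness condition makes the empirical process take values in \<open>\<ell>\<^sup>\<infinity>(G)\<close>; outer
  expectations refer to the canonical space of infinite i.i.d. sequences.\<close>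

definition Donsker :: "'z measure \<Rightarrow> ('z \<Rightarrow> real) set \<Rightarrow> bool" where
  "Donsker P G \<longleftrightarrow>
     G \<subseteq> L2 P \<and>
     (\<forall>z\<in>space P. bounded ((\<lambda>g. g z - (LINT x|P. g x)) ` G)) \<and>
     (\<exists>L. tight_borel_law (ell_infinity G) L \<and>
          converges_weakly_to (PiM UNIV (\<lambda>_::nat. P)) (ell_infinity G) (empirical_process P G) L)"


section \<open>Pathwise differentiability\<close>

text \<open>In differentiability in quadratic mean, \<open>\<mu> \<epsilon>\<close> is any measure dominating both \<open>P\<^sub>\<epsilon>\<close> and
  \<open>P\<^sub>0\<close>, with densities \<open>p \<epsilon>\<close> and \<open>q \<epsilon>\<close>; the integral does not depend on the choice of \<open>\<mu> \<epsilon>\<close>.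
  Only \<open>\<epsilon>\<close> near 0 matters, so a path defined near 0 can be extended by \<open>P\<^sub>0\<close> to all of \<open>\<real>\<close>.\<close>

definition qmd_path ::
  "'z measure set \<Rightarrow> 'z measure \<Rightarrow> (real \<Rightarrow> 'z measure) \<Rightarrow> ('z \<Rightarrow> real) \<Rightarrow> bool" where
  "qmd_path \<M> P0 Pe l \<longleftrightarrow>
     (\<forall>\<epsilon>. Pe \<epsilon> \<in> \<M>) \<and> Pe 0 = P0 \<and> l \<in> L2 P0 \<and>
     (\<exists>\<mu> p q.
        (\<forall>\<epsilon>. sigma_finite_measure (\<mu> \<epsilon>) \<and> sets (\<mu> \<epsilon>) = sets P0 \<and>
             p \<epsilon> \<in> borel_measurable (\<mu> \<epsilon>) \<and> q \<epsilon> \<in> borel_measurable (\<mu> \<epsilon>) \<and>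
             (\<forall>z. 0 \<le> p \<epsilon> z \<and> 0 \<le> q \<epsilon> z) \<and>
             Pe \<epsilon> = density (\<mu> \<epsilon>) (\<lambda>z. ennreal (p \<epsilon> z)) \<and>
             P0 = density (\<mu> \<epsilon>) (\<lambda>z. ennreal (q \<epsilon> z))) \<and>
        ((\<lambda>\<epsilon>. \<integral>\<^sup>+z. ennreal (((sqrt (p \<epsilon> z) - sqrt (q \<epsilon> z)) / \<epsilon>
                                - l z * sqrt (q \<epsilon> z) / 2)\<^sup>2) \<partial>\<mu> \<epsilon>) \<longlongrightarrow> 0) (at 0))"

text \<open>Closed linear span in \<open>L\<^sub>2(P\<^sub>0)\<close> of the scores.\<close>

definition tangent_space :: "'z measure set \<Rightarrow> 'z measure \<Rightarrow> ('z \<Rightarrow> real) set" where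
  "tangent_space \<M> P0 = {h \<in> L2 P0. \<forall>e>0. \<exists>(k::nat) c l.
      (\<forall>i<k. \<exists>Pe. qmd_path \<M> P0 Pe (l i)) \<and> L2_dist P0 h (\<lambda>z. \<Sum>i<k. c i * l i z) < e}"

definition nonparametric_efficient_influence ::
  "'z measure set \<Rightarrow> 'z measure \<Rightarrow> ('z measure \<Rightarrow> real) \<Rightarrow> ('z \<Rightarrow> real) \<Rightarrow> bool" where
  "nonparametric_efficient_influence \<M> P0 \<eta> \<phi> \<longleftrightarrow>
     tangent_space \<M> P0 = L2_zero P0 \<and> \<phi> \<in> L2_zero P0 \<and>
     (\<forall>Pe l. qmd_path \<M> P0 Pe l \<longrightarrow>
        ((\<lambda>\<epsilon>. \<eta> (Pe \<epsilon>)) has_real_derivative (LINT z|P0. \<phi> z * l z)) (at 0))"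


section \<open>Predictiveness\<close>

text \<open>A function on \<open>\<X>\<close> is represented by its extension by zero, so that equality of
  representatives is equality on \<open>\<X>\<close>. The norm lives on some linear space \<open>W\<close> of functions
  containing the class, so that differences have a norm.\<close>

definition normed_function_class ::
  "'x set \<Rightarrow> ('x \<Rightarrow> real) set \<Rightarrow> (('x \<Rightarrow> real) \<Rightarrow> real) \<Rightarrow> bool" where
  "normed_function_class \<X> \<F> N \<longleftrightarrow> (\<exists>W. \<F> \<subseteq> W \<and>
     (\<forall>f\<in>W. \<forall>x. x \<notin> \<X> \<longrightarrow> f x = 0) \<and>
     (\<lambda>x. 0) \<in> W \<and>
     (\<forall>f\<in>W. \<forall>g\<in>W. (\<lambda>x. f x + g x) \<in> W) \<and>
     (\<forall>c. \<forall>f\<in>W. (\<lambda>x. c * f x) \<in> W) \<and>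
     (\<forall>f\<in>W. 0 \<le> N f \<and> (N f = 0 \<longleftrightarrow> f = (\<lambda>x. 0))) \<and>
     (\<forall>c. \<forall>f\<in>W. N (\<lambda>x. c * f x) = \<bar>c\<bar> * N f) \<and>
     (\<forall>f\<in>W. \<forall>g\<in>W. N (\<lambda>x. f x + g x) \<le> N f + N g))"

definition excluding ::
  "(real ^ 'p) set \<Rightarrow> (real ^ 'p \<Rightarrow> real) set \<Rightarrow> 'p set \<Rightarrow> (real ^ 'p \<Rightarrow> real) set" where
  "excluding \<X> \<F> S =
     {f \<in> \<F>. \<forall>x\<in>\<X>. \<forall>x'\<in>\<X>. (\<forall>i. i \<notin> S \<longrightarrow> x $ i = x' $ i) \<longrightarrow> f x = f x'}"

text \<open>Linearity for real combinations: \<open>T\<close> is the restriction to \<open>\<M>\<close> of a linear functional on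
  the span of \<open>\<M>\<close> in the space of signed measures.\<close>

definition linear_in_measure :: "'z measure set \<Rightarrow> ('z measure \<Rightarrow> real) \<Rightarrow> bool" where
  "linear_in_measure \<M> T \<longleftrightarrow> (\<forall>\<Q> c. \<forall>R\<in>\<M>. finite \<Q> \<and> \<Q> \<subseteq> \<M> \<and>
     (\<forall>A\<in>sets R. measure R A = (\<Sum>Q\<in>\<Q>. c Q * measure Q A)) \<longrightarrow>
     T R = (\<Sum>Q\<in>\<Q>. c Q * T Q))"

text \<open>\<open>U\<close> is total on \<open>\<real>\<^sup>2\<close>, as it is evaluated at estimates and differentiated at a point.\<close>

definition predictiveness ::
  "(real \<times> real \<Rightarrow> real) \<Rightarrow> ('f \<Rightarrow> 'z measure \<Rightarrow> real) \<Rightarrow> ('z measure \<Rightarrow> real)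
     \<Rightarrow> 'f \<Rightarrow> 'z measure \<Rightarrow> real" where
  "predictiveness U \<zeta> \<eta> f P = U (\<zeta> f P, \<eta> P)"

definition predictiveness_metric ::
  "'f set \<Rightarrow> 'z measure set \<Rightarrow> (real \<times> real \<Rightarrow> real) \<Rightarrow> ('f \<Rightarrow> 'z measure \<Rightarrow> real)
     \<Rightarrow> ('z measure \<Rightarrow> real) \<Rightarrow> bool" where
  "predictiveness_metric \<F> \<M> U \<zeta> \<eta> \<longleftrightarrow>
     (\<forall>f\<in>\<F>. linear_in_measure \<M> (\<zeta> f)) \<and>
     (\<forall>f\<in>\<F>. \<forall>P\<in>\<M>. predictiveness U \<zeta> \<eta> f P \<in> {0..1})"

text \<open>\<open>V\<^sub>n\<^sub>,\<^sub>-\<^sub>S\<close>, with \<open>\<zeta>\<close> at the empirical distribution given by the empirical mean of \<open>\<zeta>' f\<close>.\<close>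

definition est_predictiveness ::
  "(real \<times> real \<Rightarrow> real) \<Rightarrow> ('f \<Rightarrow> 'z \<Rightarrow> real) \<Rightarrow> (nat \<Rightarrow> 's \<Rightarrow> (nat \<Rightarrow> 'z) \<Rightarrow> 'f)
     \<Rightarrow> (nat \<Rightarrow> (nat \<Rightarrow> 'z) \<Rightarrow> real) \<Rightarrow> nat \<Rightarrow> 's \<Rightarrow> (nat \<Rightarrow> 'z) \<Rightarrow> real" where
  "est_predictiveness U \<zeta>' fn \<eta>n n S d = U (emp_mean n d (\<zeta>' (fn n S d)), \<eta>n n d)"

definition influence ::
  "(real \<times> real \<Rightarrow> real) \<Rightarrow> ('f \<Rightarrow> 'z measure \<Rightarrow> real) \<Rightarrow> ('z measure \<Rightarrow> real)
     \<Rightarrow> ('f \<Rightarrow> 'z \<Rightarrow> real) \<Rightarrow> ('z \<Rightarrow> real) \<Rightarrow> 'z measure \<Rightarrow> 'f \<Rightarrow> 'z \<Rightarrow> real" where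
  "influence U \<zeta> \<eta> \<zeta>' \<phi> P0 f z =
     deriv (\<lambda>s. U (s, \<eta> P0)) (\<zeta> f P0) * (\<zeta>' f z - (LINT y|P0. \<zeta>' f y))
     + deriv (\<lambda>t. U (\<zeta> f P0, t)) (\<eta> P0) * \<phi> z"


section \<open>Conditions\<close>

definition zeta_representation ::
  "'f set \<Rightarrow> 'z measure set \<Rightarrow> 'z measure \<Rightarrow> ('f \<Rightarrow> 'z measure \<Rightarrow> real)
     \<Rightarrow> ('f \<Rightarrow> 'z \<Rightarrow> real) \<Rightarrow> bool" where
  "zeta_representation \<F> \<M> P0 \<zeta> \<zeta>' \<longleftrightarrow>
     (\<forall>f\<in>\<F>. \<zeta>' f \<in> L2 P0 \<and>
        (\<forall>P\<in>\<M>. integrable P (\<zeta>' f) \<and> \<zeta> f P = (LINT z|P. \<zeta>' f z)))"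

definition zeta_smooth_at ::
  "('x \<Rightarrow> real) set \<Rightarrow> ('x \<Rightarrow> real) set \<Rightarrow> (('x \<Rightarrow> real) \<Rightarrow> real) \<Rightarrow> 'z measure
     \<Rightarrow> (('x \<Rightarrow> real) \<Rightarrow> 'z \<Rightarrow> real) \<Rightarrow> ('x \<Rightarrow> real) \<Rightarrow> bool" where
  "zeta_smooth_at \<F> \<F>S N P0 \<zeta>' f0 \<longleftrightarrow>
     (\<forall>e>0. \<exists>d>0. \<forall>f\<in>\<F>. N (\<lambda>x. f x - f0 x) < d \<longrightarrow> L2_dist P0 (\<zeta>' f) (\<zeta>' f0) < e) \<and>
     (\<exists>C>0. \<exists>\<delta>>0. \<forall>f\<in>\<F>S. N (\<lambda>x. f x - f0 x) < \<delta> \<longrightarrow>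
        \<bar>LINT z|P0. \<zeta>' f z - \<zeta>' f0 z\<bar> \<le> C * (N (\<lambda>x. f x - f0 x))\<^sup>2)"

text \<open>As in \<open>little_oP\<close>, the estimated function lies in the Donsker class with probability
  tending to one in the inner sense: the outer probability of the complementary event vanishes.\<close>

definition regularity_conditions ::
  "(real ^ 'p) set \<Rightarrow> ((real ^ 'p) \<times> real) measure set \<Rightarrow> ((real ^ 'p) \<times> real) measure
   \<Rightarrow> (real ^ 'p \<Rightarrow> real) set \<Rightarrow> ((real ^ 'p \<Rightarrow> real) \<Rightarrow> real)
   \<Rightarrow> (real \<times> real \<Rightarrow> real) \<Rightarrow> ((real ^ 'p \<Rightarrow> real) \<Rightarrow> ((real ^ 'p) \<times> real) measure \<Rightarrow> real)
   \<Rightarrow> (((real ^ 'p) \<times> real) measure \<Rightarrow> real)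
   \<Rightarrow> ((real ^ 'p \<Rightarrow> real) \<Rightarrow> (real ^ 'p) \<times> real \<Rightarrow> real) \<Rightarrow> ((real ^ 'p) \<times> real \<Rightarrow> real)
   \<Rightarrow> ('p set \<Rightarrow> real ^ 'p \<Rightarrow> real) \<Rightarrow> 'w measure \<Rightarrow> (nat \<Rightarrow> 'w \<Rightarrow> (real ^ 'p) \<times> real)
   \<Rightarrow> (nat \<Rightarrow> 'p set \<Rightarrow> (nat \<Rightarrow> (real ^ 'p) \<times> real) \<Rightarrow> real ^ 'p \<Rightarrow> real)
   \<Rightarrow> (nat \<Rightarrow> (nat \<Rightarrow> (real ^ 'p) \<times> real) \<Rightarrow> real) \<Rightarrow> 'p set \<Rightarrow> bool" where
  "regularity_conditions \<X> \<M> P0 \<F> N U \<zeta> \<eta> \<zeta>' \<phi>0 f0 M Z fn \<eta>n S \<longleftrightarrow>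
     zeta_representation \<F> \<M> P0 \<zeta> \<zeta>' \<and>
     zeta_smooth_at \<F> (excluding \<X> \<F> S) N P0 \<zeta>' (f0 S) \<and>
     nonparametric_efficient_influence \<M> P0 \<eta> \<phi>0 \<and>
     U differentiable (at (\<zeta> (f0 S) P0, \<eta> P0)) \<and>
     little_oP M (\<lambda>n \<omega>. N (\<lambda>x. fn n S (sample Z n \<omega>) x - f0 S x)) (\<lambda>n. real n powr (-1/4)) \<and>
     (\<exists>G. Donsker P0 G \<and>
        (\<lambda>n. outer_measure_of M {\<omega> \<in> space M. \<zeta>' (fn n S (sample Z n \<omega>)) \<notin> G}) \<longlonglongrightarrow> 0) \<and>
     little_oP M (\<lambda>n \<omega>. \<eta>n n (sample Z n \<omega>) - \<eta> P0 - emp_mean n (sample Z n \<omega>) \<phi>0)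
       (\<lambda>n. real n powr (-1/2))"


section \<open>Selection and ranking algorithms\<close>

definition selection_algorithm ::
  "'z measure \<Rightarrow> (nat \<Rightarrow> (nat \<Rightarrow> 'z) \<Rightarrow> 'p set) \<Rightarrow> bool" where
  "selection_algorithm P0 Sn \<longleftrightarrow>
     (\<forall>n. Sn n \<in> measurable (PiM {..<n} (\<lambda>_. P0)) (count_space UNIV))"

text \<open>A permutation is the list of its elements in order, so \<open>R\<^sub>[\<^sub>j\<^sub>]\<close> is \<open>set (take j R)\<close>.\<close>

definition ranking_algorithm ::
  "'z measure \<Rightarrow> (nat \<Rightarrow> (nat \<Rightarrow> 'z) \<Rightarrow> 'p list) \<Rightarrow> bool" where
  "ranking_algorithm P0 Rn \<longleftrightarrow>
     (\<forall>n. Rn n \<in> measurable (PiM {..<n} (\<lambda>_. P0)) (count_space (permutations_of_set UNIV)))"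

definition stable_selection ::
  "'w measure \<Rightarrow> (nat \<Rightarrow> 'w \<Rightarrow> 'z) \<Rightarrow> ('p set \<Rightarrow> 'f) \<Rightarrow> (nat \<Rightarrow> (nat \<Rightarrow> 'z) \<Rightarrow> 'p set)
     \<Rightarrow> 'p set set \<Rightarrow> bool" where
  "stable_selection M Z f0 Sn \<S>0 \<longleftrightarrow>
     (\<lambda>n. measure M {\<omega> \<in> space M. Sn n (sample Z n \<omega>) \<in> \<S>0}) \<longlonglongrightarrow> 1 \<and>
     (\<forall>S\<in>\<S>0. \<forall>S'\<in>\<S>0. f0 S = f0 S')"

definition stable_ranking ::
  "'w measure \<Rightarrow> (nat \<Rightarrow> 'w \<Rightarrow> 'z) \<Rightarrow> ('p::finite set \<Rightarrow> 'f)
     \<Rightarrow> (nat \<Rightarrow> (nat \<Rightarrow> 'z) \<Rightarrow> 'p list) \<Rightarrow> 'p list set \<Rightarrow> bool" where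
  "stable_ranking M Z f0 Rn \<R>0 \<longleftrightarrow>
     \<R>0 \<subseteq> permutations_of_set UNIV \<and>
     (\<lambda>n. measure M {\<omega> \<in> space M. Rn n (sample Z n \<omega>) \<in> \<R>0}) \<longlonglongrightarrow> 1 \<and>
     (\<forall>R\<in>\<R>0. \<forall>R'\<in>\<R>0. \<forall>j\<in>{1..CARD('p)}. f0 (set (take j R)) = f0 (set (take j R')))"

end

theory Submission
  imports Defs
begin

text \<open>
  For a fixed set the error splits into the empirical process increment
  \<open>(\<bbbP>\<^sub>n - P\<^sub>0)(\<zeta>' f\<^sub>n - \<zeta>' f\<^sub>0)\<close>, a bias bounded by \<open>C \<parallel>f\<^sub>n - f\<^sub>0\<parallel>\<^sup>2\<close>, and the linear part, to which
  the delta method applies. The increment is negligible because a compact set of large mass under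
  the limit law has a finite net, so the empirical process asymptotically oscillates little on each
  cell of some finite partition of the Donsker class; this uses neither Gaussianity of the limit nor
  membership of \<open>\<zeta>' f\<^sub>0\<close> in the class. A data-dependent set costs only a finite union bound, since
  on a limiting set all candidate sets share one maximizer and hence one expansion.
\<close>

section \<open>Asymptotic bounds in outer probability\<close>

text \<open>An explicit failure budget \<open>t\<close> lets finitely many asymptotic events be
  intersected by adding budgets. Outer measure is used because events about estimated functions may
  fail to be measurable.\<close>

definition holds_up_to :: "'w measure \<Rightarrow> real \<Rightarrow> (nat \<Rightarrow> 'w \<Rightarrow> bool) \<Rightarrow> bool" where
  "holds_up_to M t Q \<longleftrightarrow>
     (\<forall>\<^sub>F n in sequentially. outer_measure_of M {\<omega> \<in> space M. \<not> Q n \<omega>} \<le> ennreal t)"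

text \<open>Measurable hulls of the same outer measure reduce this to subadditivity of
  \<open>emeasure\<close>.\<close>

lemma outer_measure_of_Un_le:
  assumes "A \<subseteq> space M" "B \<subseteq> space M"
  shows "outer_measure_of M (A \<union> B) \<le> outer_measure_of M A + outer_measure_of M B"
proof -
  obtain E F where EF: "E \<in> sets M" "A \<subseteq> E" "outer_measure_of M A = emeasure M E"
      "F \<in> sets M" "B \<subseteq> F" "outer_measure_of M B = emeasure M F"
    using outer_measure_of_attain[OF assms(1)] outer_measure_of_attain[OF assms(2)] by blast
  have "outer_measure_of M (A \<union> B) \<le> outer_measure_of M (E \<union> F)"
    using EF by (intro outer_measure_of_mono) auto
  also have "\<dots> \<le> emeasure M E + emeasure M F"
    using EF by (simp add: emeasure_subadditive)
  finally show ?thesis using EF by simp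
qed

lemma holds_up_toI:
  assumes "\<forall>\<^sub>F n in sequentially. outer_measure_of M {\<omega> \<in> space M. \<not> Q n \<omega>} \<le> ennreal t"
  shows "holds_up_to M t Q"
  using assms by (simp add: holds_up_to_def)

text \<open>The implication is required only for large \<open>n\<close>, so that its proof may
  assume \<open>0 < n\<close> or that a vanishing rate is already small.\<close>

lemma holds_up_to_mono:
  assumes "holds_up_to M t Q"
    and "\<forall>\<^sub>F n in sequentially. \<forall>\<omega>\<in>space M. Q n \<omega> \<longrightarrow> Q' n \<omega>"
  shows "holds_up_to M t Q'"
  using assms unfolding holds_up_to_def
proof eventually_elim
  case (elim n)
  then show ?case
    by (intro order_trans[OF outer_measure_of_mono elim(1)]) auto
qed

lemma holds_up_to_weaken:
  assumes "holds_up_to M s Q" "s \<le> t"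
  shows "holds_up_to M t Q"
  using assms(1) unfolding holds_up_to_def
  by eventually_elim (rule order_trans[OF _ ennreal_leI[OF assms(2)]])

lemma holds_up_to_conj:
  assumes "holds_up_to M s Q" "holds_up_to M t R" "0 \<le> s" "0 \<le> t"
  shows "holds_up_to M (s + t) (\<lambda>n \<omega>. Q n \<omega> \<and> R n \<omega>)"
  using assms(1,2) unfolding holds_up_to_def
proof eventually_elim
  case (elim n)
  have "outer_measure_of M {\<omega> \<in> space M. \<not> (Q n \<omega> \<and> R n \<omega>)} =
        outer_measure_of M ({\<omega> \<in> space M. \<not> Q n \<omega>} \<union> {\<omega> \<in> space M. \<not> R n \<omega>})"
    by (intro arg_cong2[where f=outer_measure_of] refl) auto
  also have "\<dots> \<le> ennreal s + ennreal t"
    by (intro order_trans[OF outer_measure_of_Un_le add_mono] elim) auto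
  finally show ?case using assms by simp
qed

text \<open>Union bound: each of the \<open>card I\<close> events consumes one budget
  \<open>t\<close>.\<close>

lemma holds_up_to_finite_ball:
  assumes "finite I" "\<And>i. i \<in> I \<Longrightarrow> holds_up_to M t (Q i)" "0 \<le> t"
  shows "holds_up_to M (real (card I) * t) (\<lambda>n \<omega>. \<forall>i\<in>I. Q i n \<omega>)"
  using assms(1,2)
proof (induction I rule: finite_induct)
  case empty
  then show ?case by (simp add: holds_up_to_def outer_measure_of_eq)
next
  case (insert i I)
  have "holds_up_to M (t + real (card I) * t) (\<lambda>n \<omega>. Q i n \<omega> \<and> (\<forall>i\<in>I. Q i n \<omega>))"
    using insert assms(3) by (intro holds_up_to_conj) auto
  then show ?case
    using insert by (simp add: algebra_simps)
qed

section \<open>Convergence to zero in outer probability as a family of eventual bounds\<close>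

lemma ennreal_tendsto_0_iff_eventually_le:
  fixes f :: "'a \<Rightarrow> ennreal"
  shows "(f \<longlongrightarrow> 0) F \<longleftrightarrow> (\<forall>t>0. \<forall>\<^sub>F x in F. f x \<le> ennreal t)"
proof
  assume "(f \<longlongrightarrow> 0) F"
  then show "\<forall>t>0. \<forall>\<^sub>F x in F. f x \<le> ennreal t"
    by (auto dest!: order_tendstoD(2) intro: eventually_mono less_imp_le)
next
  assume *: "\<forall>t>0. \<forall>\<^sub>F x in F. f x \<le> ennreal t"
  show "(f \<longlongrightarrow> 0) F"
  proof (rule order_tendstoI)
    fix a :: ennreal assume "0 < a"
    \<comment> \<open>Every positive \<open>ennreal\<close> has a positive real strictly below it:
      half of it if it is finite, 1 if it is infinite.\<close>
    then obtain t where t: "0 < t" "ennreal t < a"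
    proof (cases a)
      case (real r)
      with \<open>0 < a\<close> show ?thesis
        by (intro that[of "r / 2"]) (auto simp: ennreal_less_iff)
    qed (use that[of 1] in auto)
    then have "\<forall>\<^sub>F x in F. f x \<le> ennreal t" using * by simp
    then show "\<forall>\<^sub>F x in F. f x < a"
      using t by (auto elim: eventually_mono intro: le_less_trans)
  qed auto
qed

lemma outer_null_iff_holds_up_to:
  "(\<lambda>n. outer_measure_of M {\<omega> \<in> space M. \<not> Q n \<omega>}) \<longlonglongrightarrow> 0 \<longleftrightarrow> (\<forall>t>0. holds_up_to M t Q)"
  by (simp add: ennreal_tendsto_0_iff_eventually_le holds_up_to_def)

lemma little_oP_iff_holds_up_to:
  "little_oP M X r \<longleftrightarrow> (\<forall>e>0. \<forall>t>0. holds_up_to M t (\<lambda>n \<omega>. \<bar>X n \<omega>\<bar> \<le> e * r n))"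
  unfolding little_oP_def using outer_null_iff_holds_up_to[of M "\<lambda>n \<omega>. \<bar>X n \<omega>\<bar> \<le> e * r n" for e]
  by (simp add: not_le)

lemma little_oP_holds_up_to:
  "little_oP M X r \<Longrightarrow> 0 < e \<Longrightarrow> 0 < t \<Longrightarrow> holds_up_to M t (\<lambda>n \<omega>. \<bar>X n \<omega>\<bar> \<le> e * r n)"
  by (simp add: little_oP_iff_holds_up_to)

lemma little_oP_add:
  assumes "little_oP M X r" "little_oP M Y r"
  shows "little_oP M (\<lambda>n \<omega>. X n \<omega> + Y n \<omega>) r"
  unfolding little_oP_iff_holds_up_to
proof (intro allI impI)
  fix e t :: real assume et: "0 < e" "0 < t"
  have "holds_up_to M (t/2 + t/2) (\<lambda>n \<omega>. \<bar>X n \<omega>\<bar> \<le> e/2 * r n \<and> \<bar>Y n \<omega>\<bar> \<le> e/2 * r n)"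
    using et assms by (intro holds_up_to_conj little_oP_holds_up_to) auto
  then have "holds_up_to M t (\<lambda>n \<omega>. \<bar>X n \<omega>\<bar> \<le> e/2 * r n \<and> \<bar>Y n \<omega>\<bar> \<le> e/2 * r n)" by simp
  then show "holds_up_to M t (\<lambda>n \<omega>. \<bar>X n \<omega> + Y n \<omega>\<bar> \<le> e * r n)"
    by (rule holds_up_to_mono) (intro always_eventually allI ballI impI, linarith)
qed

text \<open>Once the random index lies in the finite set \<open>I\<close>, simultaneous smallness of
  all processes indexed by \<open>I\<close> suffices. This carries expansions at fixed sets over to
  a data-dependent set.\<close>

lemma little_oP_random_index:
  assumes "finite I" and L: "\<And>t. 0 < t \<Longrightarrow> holds_up_to M t (\<lambda>n \<omega>. L n \<omega> \<in> I)"
    and X: "\<And>i. i \<in> I \<Longrightarrow> little_oP M (\<lambda>n \<omega>. X i n \<omega>) r"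
  shows "little_oP M (\<lambda>n \<omega>. X (L n \<omega>) n \<omega>) r"
  unfolding little_oP_iff_holds_up_to
proof (intro allI impI)
  fix e t :: real assume et: "0 < e" "0 < t"
  \<comment> \<open>Half of \<open>t\<close> pays for the index leaving \<open>I\<close>; the other
    half is shared among the members of \<open>I\<close>. The \<open>+ 1\<close> avoids a zero
    denominator for empty \<open>I\<close>.\<close>
  define s where "s = t / (2 * (real (card I) + 1))"
  have s: "0 < s" using et by (simp add: s_def)
  have "real (card I) * s \<le> t / 2"
    using et by (simp add: s_def field_simps)
  have "holds_up_to M (t / 2 + real (card I) * s)
      (\<lambda>n \<omega>. L n \<omega> \<in> I \<and> (\<forall>i\<in>I. \<bar>X i n \<omega>\<bar> \<le> e * r n))"
    using et s assms
    by (intro holds_up_to_conj holds_up_to_finite_ball little_oP_holds_up_to) auto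
  then have "holds_up_to M (t / 2 + real (card I) * s) (\<lambda>n \<omega>. \<bar>X (L n \<omega>) n \<omega>\<bar> \<le> e * r n)"
    by (rule holds_up_to_mono) auto
  then show "holds_up_to M t (\<lambda>n \<omega>. \<bar>X (L n \<omega>) n \<omega>\<bar> \<le> e * r n)"
    by (rule holds_up_to_weaken) (use \<open>real (card I) * s \<le> t / 2\<close> in simp)
qed

text \<open>Since \<open>measure\<close> is 0 on non-measurable sets, a limit of 1 forces the events
  to be measurable for large \<open>n\<close>, and then the complement rule applies.\<close>

lemma (in prob_space) holds_up_to_if_measure_tendsto_1:
  assumes lim: "(\<lambda>n. prob {\<omega> \<in> space M. Q n \<omega>}) \<longlonglongrightarrow> 1" and t: "0 < t"
  shows "holds_up_to M t Q"
proof (rule holds_up_toI)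
  \<comment> \<open>The maximum with 0 keeps the probability strictly positive, hence the event
    measurable, also when \<open>t\<close> exceeds 1.\<close>
  have "\<forall>\<^sub>F n in sequentially. max 0 (1 - t) < prob {\<omega> \<in> space M. Q n \<omega>}"
    using order_tendstoD(1)[OF lim, of "max 0 (1 - t)"] t by simp
  then show "\<forall>\<^sub>F n in sequentially. outer_measure_of M {\<omega> \<in> space M. \<not> Q n \<omega>} \<le> ennreal t"
  proof eventually_elim
    case (elim n)
    then have meas: "{\<omega> \<in> space M. Q n \<omega>} \<in> events"
      using measure_notin_sets by fastforce
    have "{\<omega> \<in> space M. \<not> Q n \<omega>} = space M - {\<omega> \<in> space M. Q n \<omega>}" by auto
    with meas elim show ?case
      by (simp add: emeasure_eq_measure prob_compl ennreal_leI)
  qed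
qed

section \<open>The delta method\<close>

text \<open>The deviation of \<open>(A, B)\<close> from \<open>(a, b)\<close> is of order
  \<open>r\<close> in probability, so the remainder of differentiability is of smaller order. The
  bounded map \<open>D\<close> sends the two remainders of \<open>A\<close> and \<open>B\<close> to
  something of smaller order as well.\<close>

lemma little_oP_delta_method:
  fixes U :: "real \<times> real \<Rightarrow> real"
  assumes U: "(U has_derivative D) (at (a, b))"
    and A: "little_oP M (\<lambda>n \<omega>. A n \<omega> - a - S n \<omega>) r"
    and B: "little_oP M (\<lambda>n \<omega>. B n \<omega> - b - T n \<omega>) r"
    and S: "\<And>t. 0 < t \<Longrightarrow> \<exists>K. holds_up_to M t (\<lambda>n \<omega>. \<bar>S n \<omega>\<bar> \<le> K * r n)"
    and T: "\<And>t. 0 < t \<Longrightarrow> \<exists>K. holds_up_to M t (\<lambda>n \<omega>. \<bar>T n \<omega>\<bar> \<le> K * r n)"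
    and r: "r \<longlonglongrightarrow> 0" "\<And>n. 0 \<le> r n"
  shows "little_oP M (\<lambda>n \<omega>. U (A n \<omega>, B n \<omega>) - U (a, b) - D (S n \<omega>, T n \<omega>)) r"
  unfolding little_oP_iff_holds_up_to
proof (intro allI impI)
  fix e t :: real assume et: "0 < e" "0 < t"
  have D: "bounded_linear D" using U by (rule has_derivative_bounded_linear)
  then obtain C where C: "\<And>x. norm (D x) \<le> norm x * C" "0 < C"
    using bounded_linear.pos_bounded by blast
  obtain K1 K2 where K12: "holds_up_to M (t/4) (\<lambda>n \<omega>. \<bar>S n \<omega>\<bar> \<le> K1 * r n)"
      "holds_up_to M (t/4) (\<lambda>n \<omega>. \<bar>T n \<omega>\<bar> \<le> K2 * r n)"
    using S[of "t/4"] T[of "t/4"] et by auto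
  define K where "K = max 0 (max K1 K2)"
  have K: "0 \<le> K" "K1 \<le> K" "K2 \<le> K" by (auto simp: K_def)
  \<comment> \<open>The second entry makes the image of the remainders under \<open>D\<close> at
    most \<open>e / 2 * r n\<close>; the cap 1 keeps each coordinate of the deviation within
    \<open>(K + 1) * r n\<close>.\<close>
  define e1 where "e1 = min 1 (e / (4 * C))"
  \<comment> \<open>Tuned to the bound \<open>2 * (K + 1) * r n\<close> on the norm of the
    deviation, so that the remainder of differentiability costs the other
    \<open>e / 2 * r n\<close>.\<close>
  define e2 where "e2 = e / (4 * (K + 1))"
  have e1: "0 < e1" "e1 \<le> 1" "C * (2 * e1) \<le> e / 2"
    using et C by (auto simp: e1_def min_def field_simps)
  have e2: "0 < e2" "e2 * (2 * (K + 1)) = e / 2"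
    using et K by (auto simp: e2_def field_simps)
  obtain \<delta> where \<delta>: "0 < \<delta>"
      "\<And>y. norm (y - (a, b)) < \<delta> \<Longrightarrow> norm (U y - U (a, b) - D (y - (a, b))) \<le> e2 * norm (y - (a, b))"
    using U e2(1) unfolding has_derivative_at_alt by blast
  have "(\<lambda>n. 2 * (K + 1) * r n) \<longlonglongrightarrow> 2 * (K + 1) * 0"
    by (intro tendsto_intros r)
  then have ev: "\<forall>\<^sub>F n in sequentially. 2 * (K + 1) * r n < \<delta>"
    using order_tendstoD(2) \<delta>(1) by fastforce
  have "holds_up_to M (t/4 + (t/4 + (t/4 + t/4)))
     (\<lambda>n \<omega>. \<bar>S n \<omega>\<bar> \<le> K1 * r n \<and> \<bar>T n \<omega>\<bar> \<le> K2 * r n \<and>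
        \<bar>A n \<omega> - a - S n \<omega>\<bar> \<le> e1 * r n \<and> \<bar>B n \<omega> - b - T n \<omega>\<bar> \<le> e1 * r n)"
    using et e1
    by (intro holds_up_to_conj K12 little_oP_holds_up_to[OF A] little_oP_holds_up_to[OF B]) auto
  then have "holds_up_to M t
     (\<lambda>n \<omega>. \<bar>S n \<omega>\<bar> \<le> K1 * r n \<and> \<bar>T n \<omega>\<bar> \<le> K2 * r n \<and>
        \<bar>A n \<omega> - a - S n \<omega>\<bar> \<le> e1 * r n \<and> \<bar>B n \<omega> - b - T n \<omega>\<bar> \<le> e1 * r n)"
    by simp
  then show "holds_up_to M t
     (\<lambda>n \<omega>. \<bar>U (A n \<omega>, B n \<omega>) - U (a, b) - D (S n \<omega>, T n \<omega>)\<bar> \<le> e * r n)"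
  proof (rule holds_up_to_mono, use ev in eventually_elim, intro ballI impI, elim conjE)
    fix n \<omega>
    assume small: "2 * (K + 1) * r n < \<delta>" and
      S': "\<bar>S n \<omega>\<bar> \<le> K1 * r n" and T': "\<bar>T n \<omega>\<bar> \<le> K2 * r n" and
      A': "\<bar>A n \<omega> - a - S n \<omega>\<bar> \<le> e1 * r n" and B': "\<bar>B n \<omega> - b - T n \<omega>\<bar> \<le> e1 * r n"
    have norm_le: "norm (x, y) \<le> \<bar>x\<bar> + \<bar>y\<bar>" for x y :: real
      using norm_Pair_le[of x y] by simp
    have Kr: "K1 * r n \<le> K * r n" "K2 * r n \<le> K * r n" "e1 * r n \<le> 1 * r n"
      by (intro mult_right_mono K e1 r)+
    let ?y = "(A n \<omega>, B n \<omega>)"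
    let ?rest = "(A n \<omega> - a - S n \<omega>, B n \<omega> - b - T n \<omega>)"
    have dist: "norm (?y - (a, b)) \<le> 2 * (K + 1) * r n"
      using norm_le[of "A n \<omega> - a" "B n \<omega> - b"] S' T' A' B' Kr by (simp add: algebra_simps)
    have 1: "\<bar>U ?y - U (a, b) - D (?y - (a, b))\<bar> \<le> e2 * (2 * (K + 1) * r n)"
      using \<delta>(2)[of ?y] dist small e2(1) by (auto intro: order_trans mult_left_mono)
    have "\<bar>D ?rest\<bar> \<le> norm ?rest * C" using C(1)[of ?rest] by simp
    also have "\<dots> \<le> (2 * e1 * r n) * C"
      using norm_le[of "A n \<omega> - a - S n \<omega>" "B n \<omega> - b - T n \<omega>"] A' B' C(2)
      by (intro mult_right_mono) auto
    also have "\<dots> = (C * (2 * e1)) * r n" by simp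
    also have "\<dots> \<le> e / 2 * r n" by (intro mult_right_mono e1 r)
    finally have 2: "\<bar>D ?rest\<bar> \<le> e / 2 * r n" .
    \<comment> \<open>The deviation is the linear part \<open>(S, T)\<close> plus the remainders,
      and \<open>D\<close> is additive.\<close>
    have "D (?y - (a, b)) = D (S n \<omega>, T n \<omega>) + D ?rest"
      by (simp add: bounded_linear.linear[OF D] flip: linear_add)
    then have "U ?y - U (a, b) - D (S n \<omega>, T n \<omega>) =
        (U ?y - U (a, b) - D (?y - (a, b))) + D ?rest" by simp
    also have "\<bar>\<dots>\<bar> \<le> e2 * (2 * (K + 1)) * r n + e / 2 * r n"
      using 1 2 by (simp add: mult.assoc)
    also have "\<dots> = e * r n" unfolding e2(2) by simp
    finally show "\<bar>U ?y - U (a, b) - D (S n \<omega>, T n \<omega>)\<bar> \<le> e * r n" .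
  qed
qed

text \<open>Restricting \<open>U\<close> to the two coordinate lines through \<open>(a, b)\<close>
  identifies \<open>D (1, 0)\<close> and \<open>D (0, 1)\<close> with the coefficients that occur in
  \<open>influence\<close>.\<close>

lemma has_derivative_real_pair_partials:
  fixes U :: "real \<times> real \<Rightarrow> real"
  assumes U: "(U has_derivative D) (at (a, b))"
  shows "D (s, t) = deriv (\<lambda>x. U (x, b)) a * s + deriv (\<lambda>y. U (a, y)) b * t"
proof -
  have D: "linear D" using U by (metis has_derivative_bounded_linear bounded_linear.linear)
  have "((\<lambda>x. U (x, b)) has_derivative (\<lambda>h. D (h, 0))) (at a)"
    using has_derivative_compose[OF has_derivative_Pair[OF has_derivative_ident has_derivative_const] U]
    by simp
  moreover have "(\<lambda>h. D (h, 0)) = (*) (D (1, 0))"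
  proof
    fix h show "D (h, 0) = D (1, 0) * h" using linear_cmul[OF D, of h "(1, 0)"] by simp
  qed
  ultimately have 1: "deriv (\<lambda>x. U (x, b)) a = D (1, 0)"
    by (intro DERIV_imp_deriv) (metis has_derivative_eq_rhs has_field_derivative_def)
  have "((\<lambda>y. U (a, y)) has_derivative (\<lambda>h. D (0, h))) (at b)"
    using has_derivative_compose[OF has_derivative_Pair[OF has_derivative_const has_derivative_ident] U]
    by simp
  moreover have "(\<lambda>h. D (0, h)) = (*) (D (0, 1))"
  proof
    fix h show "D (0, h) = D (0, 1) * h" using linear_cmul[OF D, of h "(0, 1)"] by simp
  qed
  ultimately have 2: "deriv (\<lambda>y. U (a, y)) b = D (0, 1)"
    by (intro DERIV_imp_deriv) (metis has_derivative_eq_rhs has_field_derivative_def)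
  have "D (s, t) = D (s *\<^sub>R (1, 0) + t *\<^sub>R (0, 1))" by simp
  also have "\<dots> = s * D (1, 0) + t * D (0, 1)"
    by (simp only: linear_add[OF D] linear_cmul[OF D] real_scaleR_def)
  finally show ?thesis by (simp add: 1 2 mult.commute)
qed

section \<open>Sample means of square-integrable functions\<close>

lemma L2_integrable:
  assumes "prob_space P" "h \<in> L2 P"
  shows "integrable P h"
proof -
  interpret prob_space P by fact
  show ?thesis using assms(2) by (auto simp: L2_def intro: square_integrable_imp_integrable)
qed

lemma L2_diff:
  assumes "g \<in> L2 P" "h \<in> L2 P"
  shows "(\<lambda>z. g z - h z) \<in> L2 P"
proof -
  have [measurable]: "g \<in> borel_measurable P" "h \<in> borel_measurable P"
    and int: "integrable P (\<lambda>z. (g z)\<^sup>2)" "integrable P (\<lambda>z. (h z)\<^sup>2)"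
    using assms by (auto simp: L2_def)
  have "integrable P (\<lambda>z. (g z - h z)\<^sup>2)"
  proof (rule Bochner_Integration.integrable_bound)
    show "integrable P (\<lambda>z. 2 * (g z)\<^sup>2 + 2 * (h z)\<^sup>2)" using int by simp
    \<comment> \<open>A rearrangement of the nonnegativity of
      \<open>(x + y)\<^sup>2\<close>.\<close>
    have "(x - y)\<^sup>2 \<le> 2 * x\<^sup>2 + 2 * y\<^sup>2" for x y :: real
      using zero_le_power2[of "x + y"] by (simp add: power2_eq_square algebra_simps)
    then show "AE z in P. norm ((g z - h z)\<^sup>2) \<le> norm (2 * (g z)\<^sup>2 + 2 * (h z)\<^sup>2)"
      by (intro always_eventually allI) (simp add: abs_of_nonneg)
  qed measurable
  then show ?thesis by (simp add: L2_def)
qed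

lemma emp_mean_sample: "emp_mean n (sample Z n \<omega>) h = emp_mean n (\<lambda>i. Z i \<omega>) h"
  by (simp add: emp_mean_def sample_def)

lemma emp_mean_diff: "emp_mean n d (\<lambda>z. g z - h z) = emp_mean n d g - emp_mean n d h"
  by (simp add: emp_mean_def sum_subtractf diff_divide_distrib)

section \<open>Joint law and Chebyshev bounds for an i.i.d. sample\<close>

locale iid_sample = prob_space M for M :: "'w measure" +
  fixes P :: "'z measure" and Z :: "nat \<Rightarrow> 'w \<Rightarrow> 'z"
  assumes indep: "indep_vars (\<lambda>_. P) Z UNIV"
    and distr_Z: "distr M P (Z i) = P"
begin

lemma measurable_Z [measurable]: "Z i \<in> measurable M P"
  using indep by (auto simp: indep_vars_def)

lemma prob_space_P: "prob_space P"
  using prob_space_distr[OF measurable_Z, of 0] by (simp add: distr_Z)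

lemma sample_in_space: "\<omega> \<in> space M \<Longrightarrow> sample Z n \<omega> \<in> space (PiM {..<n} (\<lambda>_. P))"
  using measurable_space[OF measurable_Z] by (auto simp: sample_def space_PiM)

text \<open>Independence and the common marginal determine the joint law. This links
  \<open>M\<close> to the canonical sequence space on which \<open>Donsker\<close> is
  formulated.\<close>

lemma distr_sequence: "distr M (PiM UNIV (\<lambda>_. P)) (\<lambda>\<omega> i. Z i \<omega>) = PiM UNIV (\<lambda>_. P)"
  using indep_vars_iff_distr_eq_PiM[where I = UNIV and M' = "\<lambda>_. P" and X = Z] indep by (simp add: distr_Z restrict_UNIV)

text \<open>In the expanded square, independence and mean zero annihilate the off-diagonal terms,
  leaving \<open>n\<close> equal diagonal ones.\<close>

lemma integral_sample_sum_square:
  assumes h: "h \<in> L2 P" and mean: "(LINT z|P. h z) = 0"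
  shows "integrable M (\<lambda>\<omega>. (\<Sum>i<n. h (Z i \<omega>))\<^sup>2)"
    and "(LINT \<omega>|M. (\<Sum>i<n. h (Z i \<omega>))\<^sup>2) = real n * (LINT z|P. (h z)\<^sup>2)"
proof -
  have [measurable]: "h \<in> borel_measurable P" and int2: "integrable P (\<lambda>z. (h z)\<^sup>2)"
    using h by (auto simp: L2_def)
  have int: "integrable M (\<lambda>\<omega>. h (Z i \<omega>))" and E: "(LINT \<omega>|M. h (Z i \<omega>)) = 0"
    and sq: "integrable M (\<lambda>\<omega>. (h (Z i \<omega>))\<^sup>2)" "(LINT \<omega>|M. (h (Z i \<omega>))\<^sup>2) = (LINT z|P. (h z)\<^sup>2)" for i
    using L2_integrable[OF prob_space_P h] int2 mean
      integrable_distr_eq[OF measurable_Z, of h i] integral_distr[OF measurable_Z, of h i]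
      integrable_distr_eq[OF measurable_Z, of "\<lambda>z. (h z)\<^sup>2" i]
      integral_distr[OF measurable_Z, of "\<lambda>z. (h z)\<^sup>2" i]
    by (simp_all add: distr_Z)
  have cross: "integrable M (\<lambda>\<omega>. h (Z i \<omega>) * h (Z j \<omega>)) \<and>
      (LINT \<omega>|M. h (Z i \<omega>) * h (Z j \<omega>)) = (if i = j then LINT z|P. (h z)\<^sup>2 else 0)" for i j
  proof (cases "i = j")
    case False
    have "indep_vars (\<lambda>_. borel) (\<lambda>i \<omega>. h (Z i \<omega>)) {i, j}"
      by (rule indep_vars_compose2[OF indep_vars_subset[OF indep]]) auto
    from indep_vars_lebesgue_integral[OF _ this] indep_vars_integrable[OF _ this]
    show ?thesis using False int E by simp
  qed (use sq in \<open>simp add: power2_eq_square\<close>)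
  have eq: "(\<Sum>i<n. h (Z i \<omega>))\<^sup>2 = (\<Sum>i<n. \<Sum>j<n. h (Z i \<omega>) * h (Z j \<omega>))" for \<omega>
    by (simp add: power2_eq_square sum_product)
  show "integrable M (\<lambda>\<omega>. (\<Sum>i<n. h (Z i \<omega>))\<^sup>2)"
    unfolding eq using cross by auto
  show "(LINT \<omega>|M. (\<Sum>i<n. h (Z i \<omega>))\<^sup>2) = real n * (LINT z|P. (h z)\<^sup>2)"
    unfolding eq using cross by (simp add: Bochner_Integration.integral_sum)
qed

text \<open>Chebyshev's inequality at scale \<open>n powr (-1/2)\<close>: the factor
  \<open>n\<close> cancels, so the bound is uniform in \<open>n\<close>. Centring does not increase
  the second moment, which is why that of \<open>h\<close> appears.\<close>

lemma outer_measure_emp_mean_deviation: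
  assumes h: "h \<in> L2 P" and a: "0 < a" and n: "0 < n"
  shows "outer_measure_of M {\<omega> \<in> space M.
            \<not> \<bar>emp_mean n (\<lambda>i. Z i \<omega>) h - (LINT z|P. h z)\<bar> \<le> a * real n powr (-1/2)}
         \<le> ennreal ((LINT z|P. (h z)\<^sup>2) / a\<^sup>2)"
proof -
  interpret P: prob_space P by (rule prob_space_P)
  have int: "integrable P h" by (rule L2_integrable[OF prob_space_P h])
  have int2: "integrable P (\<lambda>z. (h z)\<^sup>2)" using h by (simp add: L2_def)
  define \<mu> where "\<mu> = (LINT z|P. h z)"
  define g where "g z = h z - \<mu>" for z
  define X where "X \<omega> = (\<Sum>i<n. g (Z i \<omega>))\<^sup>2" for \<omega>
  have g: "g \<in> L2 P" unfolding g_def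
    by (intro L2_diff h) (simp add: L2_def)
  have g0: "(LINT z|P. g z) = 0"
    using int by (simp add: g_def \<mu>_def P.prob_space)
  have "(LINT z|P. (g z)\<^sup>2) = (LINT z|P. (h z)\<^sup>2) - \<mu>\<^sup>2"
    using P.variance_eq[OF int int2] by (simp add: g_def \<mu>_def)
  then have v: "(LINT z|P. (g z)\<^sup>2) \<le> (LINT z|P. (h z)\<^sup>2)" by simp
  have "outer_measure_of M {\<omega> \<in> space M. \<not> \<bar>emp_mean n (\<lambda>i. Z i \<omega>) h - \<mu>\<bar> \<le> a * real n powr (-1/2)}
      \<le> outer_measure_of M {\<omega> \<in> space M. a\<^sup>2 * n \<le> X \<omega>}"
  proof (intro outer_measure_of_mono subsetI, safe)
    fix \<omega> assume "\<not> \<bar>emp_mean n (\<lambda>i. Z i \<omega>) h - \<mu>\<bar> \<le> a * real n powr (-1/2)"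
    moreover have "emp_mean n (\<lambda>i. Z i \<omega>) h - \<mu> = (\<Sum>i<n. g (Z i \<omega>)) / n"
      using n by (simp add: emp_mean_def g_def sum_subtractf field_simps)
    moreover have "real n powr (-1/2) = 1 / sqrt n"
      using n by (simp add: powr_minus_divide powr_half_sqrt)
    ultimately have "a / sqrt n < \<bar>\<Sum>i<n. g (Z i \<omega>)\<bar> / n" by (simp add: not_le)
    then have "a * (n / sqrt n) < \<bar>\<Sum>i<n. g (Z i \<omega>)\<bar>"
      using n by (simp add: field_simps)
    then have "a * sqrt n < \<bar>\<Sum>i<n. g (Z i \<omega>)\<bar>"
      by (simp add: real_div_sqrt)
    then have "(a * sqrt n)\<^sup>2 \<le> \<bar>\<Sum>i<n. g (Z i \<omega>)\<bar>\<^sup>2"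
      using a by (intro power_mono) auto
    then show "a\<^sup>2 * n \<le> X \<omega>" by (simp add: X_def power_mult_distrib)
  qed
  also have "\<dots> = emeasure M {\<omega> \<in> space M. a\<^sup>2 * n \<le> X \<omega>}"
  proof (rule outer_measure_of_eq)
    have [measurable]: "g \<in> borel_measurable P" using g by (simp add: L2_def)
    show "{\<omega> \<in> space M. a\<^sup>2 * n \<le> X \<omega>} \<in> events" unfolding X_def by measurable
  qed
  also have "\<dots> \<le> ennreal (1 / (a\<^sup>2 * n) * (LINT \<omega>|M. X \<omega>))"
    using a n integral_sample_sum_square(1)[OF g g0, of n]
    by (intro integral_Markov_inequality) (auto simp: X_def)
  also have "1 / (a\<^sup>2 * n) * (LINT \<omega>|M. X \<omega>) = (LINT z|P. (g z)\<^sup>2) / a\<^sup>2"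
    using n by (simp add: X_def integral_sample_sum_square(2)[OF g g0])
  also have "ennreal \<dots> \<le> ennreal ((LINT z|P. (h z)\<^sup>2) / a\<^sup>2)"
    using v by (intro ennreal_leI divide_right_mono) auto
  finally show ?thesis unfolding \<mu>_def .
qed

text \<open>Supplies the stochastic boundedness that the delta method asks of its linear
  terms.\<close>

lemma emp_mean_bounded_in_prob:
  assumes h: "h \<in> L2 P" and t: "0 < t"
  shows "\<exists>K. holds_up_to M t
    (\<lambda>n \<omega>. \<bar>emp_mean n (\<lambda>i. Z i \<omega>) h - (LINT z|P. h z)\<bar> \<le> K * real n powr (-1/2))"
proof -
  define v where "v = (LINT z|P. (h z)\<^sup>2)"
  have v: "0 \<le> v" by (simp add: v_def)
  \<comment> \<open>Solves \<open>v / K\<^sup>2 \<le> t\<close>; the \<open>+ 1\<close> keeps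
    \<open>K\<close> positive when \<open>v\<close> is zero.\<close>
  define K where "K = sqrt ((v + 1) / t)"
  have K: "0 < K" "v / K\<^sup>2 \<le> t" using v t by (auto simp: K_def field_simps)
  have "\<forall>\<^sub>F n in sequentially. outer_measure_of M {\<omega> \<in> space M.
            \<not> \<bar>emp_mean n (\<lambda>i. Z i \<omega>) h - (LINT z|P. h z)\<bar> \<le> K * real n powr (-1/2)} \<le> ennreal t"
    using eventually_gt_at_top[of 0]
  proof eventually_elim
    case (elim n)
    show ?case
      by (rule order_trans[OF outer_measure_emp_mean_deviation[OF h K(1) elim]])
        (use K(2) in \<open>simp add: v_def ennreal_leI\<close>)
  qed
  then show ?thesis by (intro exI[of _ K] holds_up_toI)
qed

end

section \<open>Asymptotic oscillation over a Donsker class\<close>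

lemma outer_measure_le_outer_expectation:
  assumes "prob_space M" and T: "\<And>\<omega>. \<omega> \<in> space M \<Longrightarrow> 0 \<le> T \<omega> \<and> T \<omega> \<le> 1"
    and less: "outer_expectation M T < c"
  shows "outer_measure_of M {\<omega> \<in> space M. 1 \<le> T \<omega>} \<le> ennreal c"
proof -
  interpret prob_space M by fact
  let ?A = "{(LINT \<omega>|M. U \<omega>) | U. integrable M U \<and> (\<forall>\<omega>\<in>space M. T \<omega> \<le> U \<omega>)}"
  \<comment> \<open>The constant 1 is an integrable majorant, so the infimum is taken over a
    nonempty set and a near-optimal majorant \<open>U\<close> exists. Markov's inequality for
    \<open>U\<close> at level 1 then finishes.\<close>
  have "integrable M (\<lambda>_. 1 :: real)" by simp
  with T have "?A \<noteq> {}" by blast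
  from cInf_lessD[OF this less[unfolded outer_expectation_def]]
  obtain U where U: "integrable M U" "\<And>\<omega>. \<omega> \<in> space M \<Longrightarrow> T \<omega> \<le> U \<omega>" "(LINT \<omega>|M. U \<omega>) < c"
    by blast
  have "outer_measure_of M {\<omega> \<in> space M. 1 \<le> T \<omega>} \<le> outer_measure_of M {\<omega> \<in> space M. 1 \<le> U \<omega>}"
    using U(2) by (intro outer_measure_of_mono) force
  also have "\<dots> = emeasure M {\<omega> \<in> space M. 1 \<le> U \<omega>}"
    using U(1) by (intro outer_measure_of_eq) simp
  also have "\<dots> \<le> ennreal (1 / 1 * (LINT \<omega>|M. U \<omega>))"
  proof (intro integral_Markov_inequality AE_I2)
    show "0 \<le> U \<omega>" if "\<omega> \<in> space M" for \<omega>
      using T[OF that] U(2)[OF that] by linarith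
  qed (use U(1) in simp_all)
  also have "\<dots> \<le> ennreal c" using U(3) by (intro ennreal_leI) simp
  finally show ?thesis .
qed

lemma continuous_map_real_finite_prod:
  fixes f :: "'i \<Rightarrow> 'a \<Rightarrow> real"
  assumes "finite I" "\<And>i. i \<in> I \<Longrightarrow> continuous_map X euclideanreal (f i)"
  shows "continuous_map X euclideanreal (\<lambda>x. \<Prod>i\<in>I. f i x)"
  using assms by (induction I rule: finite_induct) (auto intro: continuous_map_real_mult)

text \<open>Portmanteau argument with a continuous test function that vanishes on a compact set of
  large limit mass and equals 1 off a neighbourhood of a finite net of that set.\<close>

lemma converges_weakly_to_finite_net:
  assumes M: "prob_space M" and tight: "tight_borel_law D L" and conv: "converges_weakly_to M D X L"
    and X: "\<And>n \<omega>. \<omega> \<in> space M \<Longrightarrow> X n \<omega> \<in> mspace D"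
    and e: "0 < e" and t: "0 < t"
  obtains K where "finite K" "K \<subseteq> mspace D"
    "holds_up_to M t (\<lambda>n \<omega>. \<exists>z\<in>K. mdist D (X n \<omega>) z < e)"
proof -
  interpret D: Metric_space "mspace D" "mdist D" by simp
  have top: "D.mtopology = mtopology_of D" by (simp add: mtopology_of_def)
  interpret L: prob_space L using tight by (simp add: tight_borel_law_def)
  \<comment> \<open>Having \<open>s < t\<close> leaves strict room when passing to the limit;
    \<open>s < 1\<close> gives \<open>C\<close> positive measure and thereby measurability.\<close>
  define s where "s = min (t / 2) (1 / 2)"
  have s: "0 < s" "s < t" "s < 1" using t by (auto simp: s_def)
  obtain C where C: "compactin (mtopology_of D) C" "1 - s \<le> measure L C"
    using tight s(1) unfolding tight_borel_law_def by blast
  have C_sets: "C \<in> sets L" using C(2) s(3) measure_notin_sets[of C L] by fastforce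
  have "D.mtotally_bounded C"
    using D.compactin_imp_mtotally_bounded C(1) by (simp add: top)
  then obtain K where K: "finite K" "K \<subseteq> C" "C \<subseteq> (\<Union>x\<in>K. D.mball x (e / 2))"
    using e unfolding D.mtotally_bounded_def by (meson half_gt_zero)
  have CD: "C \<subseteq> mspace D" using C(1) by (simp add: compactin_def)
  \<comment> \<open>Each factor ramps from 0 within distance \<open>e / 2\<close> of its net point
    to 1 beyond distance \<open>e\<close>. The product vanishes near some net point, in particular
    on \<open>C\<close>, and equals 1 far from all of them.\<close>
  define \<phi> where "\<phi> x = (\<Prod>z\<in>K. min 1 (max 0 (2 * mdist D x z / e - 1)))" for x
  have \<phi>01: "0 \<le> \<phi> x \<and> \<phi> x \<le> 1" for x
    unfolding \<phi>_def by (intro conjI prod_nonneg prod_le_1) auto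
  have \<phi>_C: "\<phi> x = 0" if x: "x \<in> C" for x
  proof -
    obtain z where z: "z \<in> K" "x \<in> D.mball z (e / 2)" using K(3) x by blast
    then have "mdist D x z < e / 2" by (simp add: mdist_commute)
    then have "min 1 (max 0 (2 * mdist D x z / e - 1)) = 0" using e by (simp add: field_simps)
    then show ?thesis unfolding \<phi>_def using z(1) K(1) by (intro prod_zero) blast+
  qed
  have \<phi>_far: "\<phi> x = 1" if "\<forall>z\<in>K. \<not> mdist D x z < e" for x
    unfolding \<phi>_def
  proof (intro prod.neutral ballI)
    fix z assume "z \<in> K"
    then have "1 \<le> 2 * mdist D x z / e - 1" using that e by (simp add: le_divide_eq not_less)
    then show "min 1 (max 0 (2 * mdist D x z / e - 1)) = 1" by simp
  qed
  have cont: "continuous_map (mtopology_of D) euclideanreal \<phi>"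
    unfolding \<phi>_def
  proof (rule continuous_map_real_finite_prod[OF K(1)])
    fix z assume "z \<in> K"
    then have "z \<in> mspace D" using K(2) CD by blast
    then have "continuous_map (mtopology_of D) (mtopology_of D) (\<lambda>_. z)" by simp
    from continuous_map_mdist[OF continuous_map_id[unfolded id_def] this]
    have "continuous_map (mtopology_of D) euclideanreal (\<lambda>x. 2 / e * mdist D x z - 1)"
      by (intro continuous_map_diff continuous_map_real_mult_left) simp_all
    then show "continuous_map (mtopology_of D) euclideanreal
        (\<lambda>x. min 1 (max 0 (2 * mdist D x z / e - 1)))"
      by (intro continuous_map_real_min continuous_map_real_max) simp_all
  qed
  have bounded: "bounded (\<phi> ` mspace D)"
    using \<phi>01 by (intro boundedI[of _ 1]) auto
  have lim: "(\<lambda>n. outer_expectation M (\<lambda>\<omega>. \<phi> (X n \<omega>))) \<longlonglongrightarrow> (LINT x|L. \<phi> x)"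
    using conv[unfolded converges_weakly_to_def, rule_format, of \<phi>] cont bounded by simp
  have "(LINT x|L. \<phi> x) \<le> s"
  \<comment> \<open>Without integrability the Bochner integral has the default value 0, for which
    the bound is trivial.\<close>
  proof (cases "integrable L \<phi>")
    case True
    have "(LINT x|L. \<phi> x) \<le> (LINT x|L. indicator (space L - C) x)"
    proof (rule integral_mono[OF True])
      show "integrable L (indicator (space L - C) :: _ \<Rightarrow> real)"
        using C_sets by (simp add: L.emeasure_eq_measure)
      show "\<phi> x \<le> indicator (space L - C) x" if "x \<in> space L" for x
        using \<phi>01[of x] \<phi>_C[of x] that by (simp add: indicator_def)
    qed
    also have "\<dots> = 1 - measure L C"
      using C_sets by (simp add: L.prob_compl)
    finally show ?thesis using C(2) by simp
  qed (use s in \<open>simp add: not_integrable_integral_eq\<close>)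
  then have "\<forall>\<^sub>F n in sequentially. outer_expectation M (\<lambda>\<omega>. \<phi> (X n \<omega>)) < t"
    using s(2) by (intro order_tendstoD(2)[OF lim]) simp
  then have "holds_up_to M t (\<lambda>n \<omega>. \<exists>z\<in>K. mdist D (X n \<omega>) z < e)"
    unfolding holds_up_to_def
  proof eventually_elim
    case (elim n)
    have "outer_measure_of M {\<omega> \<in> space M. \<not> (\<exists>z\<in>K. mdist D (X n \<omega>) z < e)}
        \<le> outer_measure_of M {\<omega> \<in> space M. 1 \<le> \<phi> (X n \<omega>)}"
      by (intro outer_measure_of_mono Collect_mono) (metis \<phi>_far order_refl)
    also have "\<dots> \<le> ennreal t"
      by (rule outer_measure_le_outer_expectation[OF M _ elim]) (rule \<phi>01)
    finally show ?case .
  qed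
  then show ?thesis using that[OF K(1) subset_trans[OF K(2) CD]] by simp
qed

text \<open>A measurable cover in \<open>N\<close> pulls back along \<open>T\<close> to a measurable
  cover of the preimage with the same measure, so outer probabilities cannot grow.\<close>

lemma holds_up_to_distr:
  assumes T: "T \<in> measurable M N" and distr: "distr M N T = N" and Q: "holds_up_to N t Q"
  shows "holds_up_to M t (\<lambda>n \<omega>. Q n (T \<omega>))"
  using Q unfolding holds_up_to_def
proof eventually_elim
  case (elim n)
  obtain E where E: "E \<in> sets N" "{x \<in> space N. \<not> Q n x} \<subseteq> E"
    "outer_measure_of N {x \<in> space N. \<not> Q n x} = emeasure N E"
    using outer_measure_of_attain[of "{x \<in> space N. \<not> Q n x}" N] by auto
  have "outer_measure_of M {\<omega> \<in> space M. \<not> Q n (T \<omega>)} \<le> outer_measure_of M (T -` E \<inter> space M)"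
    using E(2) measurable_space[OF T] by (intro outer_measure_of_mono) blast
  also have "\<dots> = emeasure (distr M N T) E"
    using E(1) T by (subst outer_measure_of_eq) (auto simp: emeasure_distr)
  also have "\<dots> \<le> ennreal t" using elim by (simp add: distr E(3))
  finally show ?case .
qed

section \<open>Bounded functions on a class and paths of the empirical process\<close>

lemma in_mspace_ell_infinity:
  "f \<in> mspace (ell_infinity G) \<longleftrightarrow> f \<in> extensional G \<and> bounded (f ` G)"
  by (auto simp: ell_infinity_def Met_TC.fspace_def)

lemma dist_le_mdist_ell_infinity:
  assumes "f \<in> mspace (ell_infinity G)" "g \<in> mspace (ell_infinity G)" "x \<in> G"
  shows "\<bar>f x - g x\<bar> \<le> mdist (ell_infinity G) f g"
proof -
  have fg: "f \<in> Met_TC.fspace G" "g \<in> Met_TC.fspace G" using assms by (simp_all add: ell_infinity_def)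
  have "G \<noteq> {}" using assms(3) by blast
  then have "dist (f x) (g x) \<le> (SUP u\<in>G. dist (f u) (g u))"
    by (intro cSUP_upper[OF assms(3)] Met_TC.bdd_above_dist fg)
  with fg \<open>G \<noteq> {}\<close> show ?thesis
    by (simp add: ell_infinity_def Met_TC.fdist_def dist_real_def)
qed

text \<open>Rounding the values of all \<open>z \<in> K\<close> to a grid of mesh \<open>e\<close>
  codes each point of \<open>G\<close> by integers. Boundedness leaves finitely many codes, and the
  cells are the points sharing a code.\<close>

lemma finite_partition_small_oscillation:
  fixes K :: "('a \<Rightarrow> real) set"
  assumes "finite K" and bounded: "\<And>z. z \<in> K \<Longrightarrow> bounded (z ` G)" and e: "0 < e"
  obtains C where "finite C" "\<Union>C = G"
    "\<forall>A\<in>C. \<forall>f\<in>A. \<forall>g\<in>A. \<forall>z\<in>K. \<bar>z f - z g\<bar> \<le> e"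
proof -
  define c where "c g = (\<lambda>z\<in>K. \<lfloor>z g / e\<rfloor>)" for g
  have "\<exists>B. \<forall>g\<in>G. \<bar>z g\<bar> \<le> B" if "z \<in> K" for z
    using bounded[OF that] by (simp add: bounded_iff)
  then obtain B where B: "\<And>z g. z \<in> K \<Longrightarrow> g \<in> G \<Longrightarrow> \<bar>z g\<bar> \<le> B z" by metis
  have "c ` G \<subseteq> (\<Pi>\<^sub>E z\<in>K. {\<lfloor>- B z / e\<rfloor>..\<lfloor>B z / e\<rfloor>})"
  proof (intro image_subsetI)
    fix g assume g: "g \<in> G"
    have "\<lfloor>- B z / e\<rfloor> \<le> \<lfloor>z g / e\<rfloor> \<and> \<lfloor>z g / e\<rfloor> \<le> \<lfloor>B z / e\<rfloor>" if "z \<in> K" for z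
      using B[OF that g] e by (intro conjI floor_mono divide_right_mono) auto
    then show "c g \<in> (\<Pi>\<^sub>E z\<in>K. {\<lfloor>- B z / e\<rfloor>..\<lfloor>B z / e\<rfloor>})"
      by (auto simp: c_def)
  qed
  moreover have "finite (\<Pi>\<^sub>E z\<in>K. {\<lfloor>- B z / e\<rfloor>..\<lfloor>B z / e\<rfloor>})"
    using assms(1) by (intro finite_PiE) auto
  ultimately have fin: "finite (c ` G)" by (rule finite_subset)
  show ?thesis
  proof (rule that)
    show "finite ((\<lambda>v. {g \<in> G. c g = v}) ` c ` G)" using fin by (rule finite_imageI)
    show "\<Union> ((\<lambda>v. {g \<in> G. c g = v}) ` c ` G) = G" by auto
    have "\<bar>z f - z g\<bar> \<le> e" if "A \<in> (\<lambda>v. {g \<in> G. c g = v}) ` c ` G" "f \<in> A" "g \<in> A" and z: "z \<in> K"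
      for A f g z
    proof -
      have "c f z = c g z" using that by auto
      then have "\<lfloor>z f / e\<rfloor> = \<lfloor>z g / e\<rfloor>" using z by (simp add: c_def)
      then have "\<bar>z f / e - z g / e\<bar> < 1" by linarith
      then have "\<bar>(z f - z g) / e\<bar> < 1" by (simp add: diff_divide_distrib)
      then show ?thesis using e by simp
    qed
    then show "\<forall>A\<in>(\<lambda>v. {g \<in> G. c g = v}) ` c ` G. \<forall>f\<in>A. \<forall>g\<in>A. \<forall>z\<in>K. \<bar>z f - z g\<bar> \<le> e"
      by blast
  qed
qed

text \<open>The pointwise bound over \<open>G\<close> at each of the \<open>n\<close> observations
  adds up to a bound on the average.\<close>

lemma empirical_process_in_ell_infinity:
  assumes "\<forall>z\<in>space P. bounded ((\<lambda>g. g z - (LINT x|P. g x)) ` G)"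
    and d: "\<And>i. i < n \<Longrightarrow> d i \<in> space P"
  shows "empirical_process P G n d \<in> mspace (ell_infinity G)"
proof -
  have "\<exists>B. \<forall>g\<in>G. \<bar>g (d i) - (LINT x|P. g x)\<bar> \<le> B" if "i < n" for i
    using assms(1) d[OF that] by (simp add: bounded_iff)
  then obtain B where B: "\<And>i g. i < n \<Longrightarrow> g \<in> G \<Longrightarrow> \<bar>g (d i) - (LINT x|P. g x)\<bar> \<le> B i" by metis
  have "norm (empirical_process P G n d g) \<le> sqrt n * ((\<Sum>i<n. B i) / n)" if "g \<in> G" for g
  \<comment> \<open>For \<open>n = 0\<close> the factor \<open>sqrt 0\<close> makes the process
    vanish.\<close>
  proof (cases "n = 0")
    case False
    have "emp_mean n d g - (LINT z|P. g z) = (\<Sum>i<n. g (d i) - (LINT x|P. g x)) / n"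
      using False by (simp add: emp_mean_def sum_subtractf field_simps)
    moreover have "\<bar>\<Sum>i<n. g (d i) - (LINT x|P. g x)\<bar> \<le> (\<Sum>i<n. B i)"
      by (intro order_trans[OF sum_abs] sum_mono B that) simp
    ultimately have "\<bar>emp_mean n d g - (LINT z|P. g z)\<bar> \<le> (\<Sum>i<n. B i) / n"
      by (simp add: divide_right_mono)
    from mult_left_mono[OF this, of "sqrt n"] show ?thesis
      using that by (simp add: empirical_process_def abs_mult)
  qed (simp add: empirical_process_def that)
  then have "bounded (empirical_process P G n d ` G)" by (intro boundedI) blast
  then show ?thesis by (simp add: in_mspace_ell_infinity empirical_process_def)
qed

section \<open>Asymptotic equicontinuity of the empirical process\<close>

context iid_sample
begin

abbreviation dev :: "nat \<Rightarrow> 'w \<Rightarrow> ('z \<Rightarrow> real) \<Rightarrow> real" where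
  "dev n \<omega> h \<equiv> emp_mean n (\<lambda>i. Z i \<omega>) h - (LINT z|P. h z)"

text \<open>Tightness of the limit law alone, with no reference to the \<open>L\<^sub>2\<close> metric on \<open>G\<close>, bounds the
  oscillation of the empirical process on the cells of a finite partition of \<open>G\<close>.\<close>

lemma Donsker_partition:
  assumes G: "Donsker P G" and e: "0 < e" and t: "0 < t"
  obtains C where "finite C" "\<Union>C = G"
    "holds_up_to M t (\<lambda>n \<omega>. \<forall>A\<in>C. \<forall>f\<in>A. \<forall>g\<in>A. \<bar>dev n \<omega> f - dev n \<omega> g\<bar> \<le> e * real n powr (-1/2))"
proof -
  define S where "S = PiM UNIV (\<lambda>_::nat. P)"
  have bounded: "\<forall>z\<in>space P. bounded ((\<lambda>g. g z - (LINT x|P. g x)) ` G)"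
    using G by (simp add: Donsker_def)
  have T: "(\<lambda>\<omega> i. Z i \<omega>) \<in> measurable M S"
    unfolding S_def using measurable_space[OF measurable_Z] by (intro measurable_PiM_single') auto
  have S: "prob_space S" using prob_space_distr[OF T] distr_sequence by (simp add: S_def)
  \<comment> \<open>One third each for the distance from the process to a net point at
    \<open>f\<close>, the same at \<open>g\<close>, and the oscillation of that net point on a
    cell.\<close>
  have e3: "0 < e / 3" using e by simp
  obtain L where L: "tight_borel_law (ell_infinity G) L"
      "converges_weakly_to S (ell_infinity G) (empirical_process P G) L"
    using G by (auto simp: Donsker_def S_def)
  have X: "empirical_process P G n d \<in> mspace (ell_infinity G)" if "d \<in> space S" for n d
    using that by (intro empirical_process_in_ell_infinity[OF bounded]) (auto simp: S_def space_PiM)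
  obtain K where K: "finite K" "K \<subseteq> mspace (ell_infinity G)"
      "holds_up_to S t (\<lambda>n d. \<exists>z\<in>K. mdist (ell_infinity G) (empirical_process P G n d) z < e / 3)"
    by (rule converges_weakly_to_finite_net[OF S L X e3 t])
  have bounded_K: "bounded (z ` G)" if "z \<in> K" for z
    using K(2) that in_mspace_ell_infinity by blast
  obtain C where C: "finite C" "\<Union>C = G"
      "\<forall>A\<in>C. \<forall>f\<in>A. \<forall>g\<in>A. \<forall>z\<in>K. \<bar>z f - z g\<bar> \<le> e / 3"
    by (rule finite_partition_small_oscillation[OF K(1) bounded_K e3])
  have "distr M S (\<lambda>\<omega> i. Z i \<omega>) = S" using distr_sequence by (simp add: S_def)
  \<comment> \<open>The net was found on the canonical sequence space; the law of the whole sample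
    sequence carries it back to \<open>M\<close>.\<close>
  from holds_up_to_distr[OF T this K(3)]
  have "holds_up_to M t
    (\<lambda>n \<omega>. \<forall>A\<in>C. \<forall>f\<in>A. \<forall>g\<in>A. \<bar>dev n \<omega> f - dev n \<omega> g\<bar> \<le> e * real n powr (-1/2))"
  proof (rule holds_up_to_mono, use eventually_gt_at_top[of "0::nat"] in eventually_elim,
      intro ballI impI, elim bexE)
    fix n \<omega> z A f g
    assume n: "0 < n" and \<omega>: "\<omega> \<in> space M" and A: "A \<in> C" "f \<in> A" "g \<in> A" and z: "z \<in> K"
      and dist: "mdist (ell_infinity G) (empirical_process P G n (\<lambda>i. Z i \<omega>)) z < e / 3"
    let ?X = "empirical_process P G n (\<lambda>i. Z i \<omega>)"
    have fg: "f \<in> G" "g \<in> G" using A C(2) by auto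
    have X: "?X \<in> mspace (ell_infinity G)"
      using \<omega> measurable_space[OF measurable_Z] by (intro empirical_process_in_ell_infinity[OF bounded])
    have "\<bar>?X x - z x\<bar> < e / 3" if "x \<in> G" for x
      using dist_le_mdist_ell_infinity[OF X _ that, of z] K(2) z dist by fastforce
    from this[OF fg(1)] this[OF fg(2)] C(3)[rule_format, OF A z]
    have "\<bar>?X f - ?X g\<bar> \<le> e" by linarith
    moreover have "?X f - ?X g = sqrt n * (dev n \<omega> f - dev n \<omega> g)"
      using fg by (simp add: empirical_process_def right_diff_distrib)
    ultimately have "\<bar>dev n \<omega> f - dev n \<omega> g\<bar> * sqrt n \<le> e" by (simp add: abs_mult mult.commute)
    then have "\<bar>dev n \<omega> f - dev n \<omega> g\<bar> \<le> e / sqrt n" using n by (simp add: pos_le_divide_eq)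
    moreover have "real n powr (-1/2) = 1 / sqrt n"
      using n by (simp add: powr_minus_divide powr_half_sqrt)
    ultimately show "\<bar>dev n \<omega> f - dev n \<omega> g\<bar> \<le> e * real n powr (-1/2)" by (simp only: times_divide_eq_right mult_1_right)
  qed
  with C(1,2) show ?thesis by (rule that)
qed

text \<open>The limit \<open>h\<close> need not belong to \<open>G\<close>: in every cell that meets the \<open>L\<^sub>2\<close> ball around \<open>h\<close> a
  fixed representative of the cell is compared with \<open>h\<close> by Chebyshev's inequality.\<close>

lemma Donsker_dev_negligible:
  assumes G: "Donsker P G" and h: "h \<in> L2 P"
    and in_G: "\<And>t. 0 < t \<Longrightarrow> holds_up_to M t (\<lambda>n \<omega>. g n \<omega> \<in> G)"
    and close: "\<And>\<delta> t. 0 < \<delta> \<Longrightarrow> 0 < t \<Longrightarrow> holds_up_to M t (\<lambda>n \<omega>. L2_dist P (g n \<omega>) h < \<delta>)"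
  shows "little_oP M (\<lambda>n \<omega>. dev n \<omega> (g n \<omega>) - dev n \<omega> h) (\<lambda>n. real n powr (-1/2))"
  unfolding little_oP_iff_holds_up_to
proof (intro allI impI)
  fix e t :: real assume e: "0 < e" and t: "0 < t"
  have e2: "0 < e / 2" and t4: "0 < t / 4" using e t by simp_all
  obtain C where C: "finite C" "\<Union>C = G" and osc: "holds_up_to M (t/4)
      (\<lambda>n \<omega>. \<forall>A\<in>C. \<forall>f\<in>A. \<forall>g\<in>A. \<bar>dev n \<omega> f - dev n \<omega> g\<bar> \<le> e / 2 * real n powr (-1/2))"
    by (rule Donsker_partition[OF G e2 t4])
  \<comment> \<open>The partition, hence the number of cells, is fixed first; each cell then
    receives a share of the budget \<open>t / 4\<close>.\<close>
  define s where "s = t / (4 * (real (card C) + 1))"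
  have s: "0 < s" "real (card C) * s \<le> t / 4" using t by (auto simp: s_def field_simps)
  \<comment> \<open>Chosen so that the Chebyshev bound for a function within \<delta> of
    \<open>h\<close> is at most \<open>s\<close>.\<close>
  define \<delta> where "\<delta> = e / 2 * sqrt s"
  have \<delta>: "0 < \<delta>" "\<delta>\<^sup>2 / (e / 2)\<^sup>2 = s"
    using e s by (auto simp: \<delta>_def power_mult_distrib power_divide)
  \<comment> \<open>Only cells meeting the ball around \<open>h\<close> matter, since the cell of
    \<open>g n \<omega>\<close> is one of them once \<open>g n \<omega>\<close> is close to
    \<open>h\<close>. Their representatives are deterministic, so Chebyshev's inequality applies to
    them, which it does not do directly to the random \<open>g n \<omega>\<close>.\<close>
  define C' where "C' = {A \<in> C. \<exists>f\<in>A. L2_dist P f h < \<delta>}"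
  have C': "C' \<subseteq> C" "finite C'" using C(1) by (auto simp: C'_def)
  obtain \<gamma> where \<gamma>: "\<And>A. A \<in> C' \<Longrightarrow> \<gamma> A \<in> A \<and> L2_dist P (\<gamma> A) h < \<delta>"
    using bchoice[of C' "\<lambda>A f. f \<in> A \<and> L2_dist P f h < \<delta>"] by (auto simp: C'_def)
  have "holds_up_to M s (\<lambda>n \<omega>. \<bar>dev n \<omega> (\<gamma> A) - dev n \<omega> h\<bar> \<le> e / 2 * real n powr (-1/2))"
    if A: "A \<in> C'" for A
  proof -
    have "\<gamma> A \<in> G" using \<gamma>[OF A] A C'(1) C(2) by blast
    then have \<gamma>2: "\<gamma> A \<in> L2 P" using G by (auto simp: Donsker_def)
    have diff: "dev n \<omega> (\<lambda>z. \<gamma> A z - h z) = dev n \<omega> (\<gamma> A) - dev n \<omega> h" for n \<omega>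
      by (simp add: emp_mean_diff Bochner_Integration.integral_diff L2_integrable[OF prob_space_P] \<gamma>2 h)
    have "sqrt (LINT z|P. (\<gamma> A z - h z)\<^sup>2) < \<delta>" using \<gamma>[OF A] by (simp add: L2_dist_def)
    then have "(LINT z|P. (\<gamma> A z - h z)\<^sup>2) \<le> \<delta>\<^sup>2"
      by (intro sqrt_le_D) simp
    then have "(LINT z|P. (\<gamma> A z - h z)\<^sup>2) / (e / 2)\<^sup>2 \<le> \<delta>\<^sup>2 / (e / 2)\<^sup>2"
      by (rule divide_right_mono) simp
    then have le: "ennreal ((LINT z|P. (\<gamma> A z - h z)\<^sup>2) / (e / 2)\<^sup>2) \<le> ennreal s"
      unfolding \<delta>(2) by (rule ennreal_leI)
    show ?thesis
    proof (rule holds_up_toI, use eventually_gt_at_top[of "0::nat"] in eventually_elim)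
      fix n :: nat assume n: "0 < n"
      from outer_measure_emp_mean_deviation[OF L2_diff[OF \<gamma>2 h] half_gt_zero[OF e] n, unfolded diff] le
      show "outer_measure_of M {\<omega> \<in> space M.
          \<not> \<bar>dev n \<omega> (\<gamma> A) - dev n \<omega> h\<bar> \<le> e / 2 * real n powr (-1/2)} \<le> ennreal s"
        by (rule order_trans)
    qed
  qed
  then have rep: "holds_up_to M (real (card C') * s)
      (\<lambda>n \<omega>. \<forall>A\<in>C'. \<bar>dev n \<omega> (\<gamma> A) - dev n \<omega> h\<bar> \<le> e / 2 * real n powr (-1/2))"
    using s(1) C'(2) by (intro holds_up_to_finite_ball) auto
  have "real (card C') * s \<le> real (card C) * s"
    using s(1) card_mono[OF C(1) C'(1)] by (intro mult_right_mono) auto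
  with s(2) have "real (card C') * s \<le> t / 4" by linarith
  from holds_up_to_weaken[OF rep this]
  have "holds_up_to M (t/4 + (t/4 + (t/4 + t/4))) (\<lambda>n \<omega>.
      (\<forall>A\<in>C. \<forall>f\<in>A. \<forall>g\<in>A. \<bar>dev n \<omega> f - dev n \<omega> g\<bar> \<le> e / 2 * real n powr (-1/2)) \<and>
      (\<forall>A\<in>C'. \<bar>dev n \<omega> (\<gamma> A) - dev n \<omega> h\<bar> \<le> e / 2 * real n powr (-1/2)) \<and>
      g n \<omega> \<in> G \<and> L2_dist P (g n \<omega>) h < \<delta>)"
    using t \<delta>(1) by (intro holds_up_to_conj osc in_G close) simp_all
  then have "holds_up_to M (t/4 + (t/4 + (t/4 + t/4)))
      (\<lambda>n \<omega>. \<bar>dev n \<omega> (g n \<omega>) - dev n \<omega> h\<bar> \<le> e * real n powr (-1/2))"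
  proof (rule holds_up_to_mono, intro always_eventually allI ballI impI, elim conjE)
    fix n \<omega>
    define r where "r = real n powr (-1/2)"
    assume osc: "\<forall>A\<in>C. \<forall>f\<in>A. \<forall>g\<in>A. \<bar>dev n \<omega> f - dev n \<omega> g\<bar> \<le> e / 2 * real n powr (-1/2)"
      and rep: "\<forall>A\<in>C'. \<bar>dev n \<omega> (\<gamma> A) - dev n \<omega> h\<bar> \<le> e / 2 * real n powr (-1/2)"
      and g: "g n \<omega> \<in> G" "L2_dist P (g n \<omega>) h < \<delta>"
    obtain A where A: "A \<in> C" "g n \<omega> \<in> A" using g(1) C(2) by blast
    then have "A \<in> C'" using g(2) by (auto simp: C'_def)
    then have "\<bar>dev n \<omega> (g n \<omega>) - dev n \<omega> (\<gamma> A)\<bar> \<le> e / 2 * r"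
        "\<bar>dev n \<omega> (\<gamma> A) - dev n \<omega> h\<bar> \<le> e / 2 * r"
      using osc rep A \<gamma> unfolding r_def by blast+
    then show "\<bar>dev n \<omega> (g n \<omega>) - dev n \<omega> h\<bar> \<le> e * real n powr (-1/2)"
      unfolding r_def[symmetric] by linarith
  qed
  then show "holds_up_to M t (\<lambda>n \<omega>. \<bar>dev n \<omega> (g n \<omega>) - dev n \<omega> h\<bar> \<le> e * real n powr (-1/2))"
    by (rule holds_up_to_weaken) simp
qed

end

section \<open>Expansion for a fixed and for a random set of excluded covariates\<close>

lemma little_oP_cong:
  assumes "little_oP M X r" and eq: "\<forall>\<^sub>F n in sequentially. \<forall>\<omega>\<in>space M. X n \<omega> = Y n \<omega>"
  shows "little_oP M Y r"
  unfolding little_oP_iff_holds_up_to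
proof (intro allI impI)
  fix e t :: real assume "0 < e" "0 < t"
  with assms(1) have "holds_up_to M t (\<lambda>n \<omega>. \<bar>X n \<omega>\<bar> \<le> e * r n)" by (rule little_oP_holds_up_to)
  then show "holds_up_to M t (\<lambda>n \<omega>. \<bar>Y n \<omega>\<bar> \<le> e * r n)"
    by (rule holds_up_to_mono, use eq in eventually_elim) simp
qed

lemma real_powr_neg_tendsto_0:
  assumes "0 < a"
  shows "(\<lambda>n. real n powr (- a)) \<longlonglongrightarrow> 0"
  using assms by (intro tendsto_neg_powr filterlim_real_sequentially) auto

text \<open>A vanishing rate eventually falls below any fixed threshold. This places the estimated
  function in the neighbourhood where the local smoothness conditions apply.\<close>

lemma little_oP_vanishing_rate_less:
  assumes X: "little_oP M X r" and r: "r \<longlonglongrightarrow> 0" and d: "0 < d" and c: "0 < c" and t: "0 < t"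
  shows "holds_up_to M t (\<lambda>n \<omega>. \<bar>X n \<omega>\<bar> \<le> c * r n \<and> X n \<omega> < d)"
proof -
  have "(\<lambda>n. c * r n) \<longlonglongrightarrow> c * 0" by (intro tendsto_intros r)
  then have "\<forall>\<^sub>F n in sequentially. c * r n < d" using order_tendstoD(2)[of _ "c * 0" _ d] d by simp
  then show ?thesis
    by (intro holds_up_to_mono[OF little_oP_holds_up_to[OF X c t]]) (auto elim: eventually_mono)
qed

text \<open>Squaring the rate \<open>n powr (-1/4)\<close> gives \<open>n powr (-1/2)\<close>, so a
  quadratic bias is negligible.\<close>

lemma little_oP_of_quadratic_bound:
  assumes N: "little_oP M N (\<lambda>n. real n powr (-1/4))" and C: "0 < C" and \<delta>: "0 < \<delta>"
    and bound: "\<And>n \<omega>. \<omega> \<in> space M \<Longrightarrow> N n \<omega> < \<delta> \<Longrightarrow> \<bar>X n \<omega>\<bar> \<le> C * (N n \<omega>)\<^sup>2"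
  shows "little_oP M X (\<lambda>n. real n powr (-1/2))"
  unfolding little_oP_iff_holds_up_to
proof (intro allI impI)
  fix e t :: real assume e: "0 < e" and t: "0 < t"
  \<comment> \<open>Makes \<open>C\<close> times the squared bound equal to
    \<open>e * n powr (-1/2)\<close>.\<close>
  define c where "c = sqrt (e / C)"
  have c: "0 < c" "C * c\<^sup>2 = e" using e C by (auto simp: c_def)
  have "(\<lambda>n. real n powr (-1/4)) \<longlonglongrightarrow> 0" using real_powr_neg_tendsto_0[of "1/4"] by simp
  from little_oP_vanishing_rate_less[OF N this \<delta> c(1) t]
  show "holds_up_to M t (\<lambda>n \<omega>. \<bar>X n \<omega>\<bar> \<le> e * real n powr (-1/2))"
  proof (rule holds_up_to_mono, intro always_eventually allI ballI impI, elim conjE)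
    fix n \<omega> assume \<omega>: "\<omega> \<in> space M" and le: "\<bar>N n \<omega>\<bar> \<le> c * real n powr (-1/4)" and less: "N n \<omega> < \<delta>"
    have "(real n powr (-1/4))\<^sup>2 = real n powr (-1/4 + -1/4)"
      unfolding power2_eq_square by (rule powr_add[symmetric])
    then have sq: "(real n powr (-1/4))\<^sup>2 = real n powr (-1/2)" by simp
    have "(N n \<omega>)\<^sup>2 \<le> (c * real n powr (-1/4))\<^sup>2"
      using power_mono[OF le abs_ge_zero, of 2] by simp
    then have "C * (N n \<omega>)\<^sup>2 \<le> C * (c * real n powr (-1/4))\<^sup>2"
      by (rule mult_left_mono) (use C in simp)
    also have "\<dots> = (C * c\<^sup>2) * real n powr (-1/2)"
      unfolding power_mult_distrib sq by (rule mult.assoc[symmetric])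
    finally show "\<bar>X n \<omega>\<bar> \<le> e * real n powr (-1/2)"
      unfolding c(2) using bound[OF \<omega> less] by (rule order_trans[rotated])
  qed
qed

text \<open>The empirical mean is linear and reproduces the constant
  \<open>LINT y|P. \<zeta>' f y\<close> for positive \<open>n\<close>; at \<open>n = 0\<close>
  division by zero would return 0 instead.\<close>

lemma emp_mean_influence:
  assumes "0 < n"
  shows "emp_mean n d (influence U \<zeta> \<eta> \<zeta>' \<phi> P f) =
    deriv (\<lambda>s. U (s, \<eta> P)) (\<zeta> f P) * (emp_mean n d (\<zeta>' f) - (LINT y|P. \<zeta>' f y))
    + deriv (\<lambda>t. U (\<zeta> f P, t)) (\<eta> P) * emp_mean n d \<phi>"
proof -
  have "(\<Sum>i<n. a * (g i - m) + b * h i) / n = a * ((\<Sum>i<n. g i) / n - m) + b * ((\<Sum>i<n. h i) / n)"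
    for a b m :: real and g h :: "nat \<Rightarrow> real"
    using assms by (simp add: sum.distrib sum_subtractf field_simps flip: sum_distrib_left)
  then show ?thesis by (simp add: emp_mean_def influence_def)
qed

lemma est_predictiveness_expansion:
  assumes iid: "iid_sample M P0 Z" and P0: "P0 \<in> \<M>" and f0: "f0 S \<in> \<F>"
    and fn: "\<And>n d. d \<in> space (PiM {..<n} (\<lambda>_. P0)) \<Longrightarrow> fn n S d \<in> excluding \<X> \<F> S"
    and reg: "regularity_conditions \<X> \<M> P0 \<F> N U \<zeta> \<eta> \<zeta>' \<phi>0 f0 M Z fn \<eta>n S"
  shows "little_oP M (\<lambda>n \<omega>. est_predictiveness U \<zeta>' fn \<eta>n n S (sample Z n \<omega>)
      - predictiveness U \<zeta> \<eta> (f0 S) P0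
      - emp_mean n (sample Z n \<omega>) (influence U \<zeta> \<eta> \<zeta>' \<phi>0 P0 (f0 S))) (\<lambda>n. real n powr (-1/2))"
proof -
  interpret iid_sample M P0 Z by fact
  define r where "r n = real n powr (-1/2)" for n
  define g where "g n \<omega> = fn n S (sample Z n \<omega>)" for n \<omega>
  define a where "a = \<zeta> (f0 S) P0"
  define b where "b = \<eta> P0"
  define h where "h = \<zeta>' (f0 S)"
  define B where "B n \<omega> = \<eta>n n (sample Z n \<omega>)" for n \<omega>
  have rep: "zeta_representation \<F> \<M> P0 \<zeta> \<zeta>'"
    and smooth: "zeta_smooth_at \<F> (excluding \<X> \<F> S) N P0 \<zeta>' (f0 S)"
    and eif: "nonparametric_efficient_influence \<M> P0 \<eta> \<phi>0"
    and diff: "U differentiable (at (a, b))"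
    and rate: "little_oP M (\<lambda>n \<omega>. N (\<lambda>x. g n \<omega> x - f0 S x)) (\<lambda>n. real n powr (-1/4))"
    and B: "little_oP M (\<lambda>n \<omega>. B n \<omega> - b - emp_mean n (sample Z n \<omega>) \<phi>0) r"
    using reg by (auto simp: regularity_conditions_def a_def b_def g_def B_def r_def[abs_def])
  obtain G where G: "Donsker P0 G"
      "(\<lambda>n. outer_measure_of M {\<omega> \<in> space M. \<zeta>' (g n \<omega>) \<notin> G}) \<longlonglongrightarrow> 0"
    using reg unfolding regularity_conditions_def g_def by blast
  have "excluding \<X> \<F> S \<subseteq> \<F>" unfolding excluding_def by (rule Collect_restrict)
  \<comment> \<open>Estimators are constrained only on the sample space of the data, hence the
    restriction to \<open>space M\<close>.\<close>
  then have g: "g n \<omega> \<in> excluding \<X> \<F> S" "g n \<omega> \<in> \<F>" if "\<omega> \<in> space M" for n \<omega>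
    using fn[OF sample_in_space[OF that, of n]] unfolding g_def by blast+
  have L2: "\<zeta>' f \<in> L2 P0" and int: "integrable P0 (\<zeta>' f)" and \<zeta>: "\<zeta> f P0 = (LINT z|P0. \<zeta>' f z)"
    if "f \<in> \<F>" for f
    using rep that P0 unfolding zeta_representation_def by blast+
  have h: "h \<in> L2 P0" using L2[OF f0] by (simp add: h_def)
  \<comment> \<open>Continuity of \<open>\<zeta>'\<close> at \<open>f0 S\<close> turns convergence
    in the norm \<open>N\<close> into convergence in \<open>L2_dist\<close>, as the Donsker argument
    requires.\<close>
  have close: "holds_up_to M t (\<lambda>n \<omega>. L2_dist P0 (\<zeta>' (g n \<omega>)) h < \<delta>)"
    if \<delta>: "0 < \<delta>" and t: "0 < t" for \<delta> t
  proof -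
    obtain d where d: "0 < d"
      "\<And>f. f \<in> \<F> \<Longrightarrow> N (\<lambda>x. f x - f0 S x) < d \<Longrightarrow> L2_dist P0 (\<zeta>' f) (\<zeta>' (f0 S)) < \<delta>"
      using smooth \<delta> unfolding zeta_smooth_at_def by meson
    have "(\<lambda>n. real n powr (-1/4)) \<longlonglongrightarrow> 0" using real_powr_neg_tendsto_0[of "1/4"] by simp
    from little_oP_vanishing_rate_less[OF rate this d(1) zero_less_one t]
    show ?thesis
      by (rule holds_up_to_mono, intro always_eventually allI ballI impI)
        (auto simp: h_def intro!: d(2) g)
  qed
  have "little_oP M (\<lambda>n \<omega>. dev n \<omega> (\<zeta>' (g n \<omega>)) - dev n \<omega> h) r"
    unfolding r_def
    using G(2) outer_null_iff_holds_up_to[of M "\<lambda>n \<omega>. \<zeta>' (g n \<omega>) \<in> G"]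
    by (intro Donsker_dev_negligible[OF G(1) h] close) auto
  moreover obtain C \<delta> where C: "0 < C" "0 < \<delta>" "\<And>f. f \<in> excluding \<X> \<F> S \<Longrightarrow>
      N (\<lambda>x. f x - f0 S x) < \<delta> \<Longrightarrow> \<bar>LINT z|P0. \<zeta>' f z - \<zeta>' (f0 S) z\<bar> \<le> C * (N (\<lambda>x. f x - f0 S x))\<^sup>2"
    using smooth unfolding zeta_smooth_at_def by meson
  then have "little_oP M (\<lambda>n \<omega>. LINT z|P0. \<zeta>' (g n \<omega>) z - h z) r"
    unfolding r_def h_def
    by (intro little_oP_of_quadratic_bound[OF rate C(1,2)]) (simp add: g(1))
  \<comment> \<open>Adding the bias to the increment cancels the integral of
    \<open>\<zeta>' (g n \<omega>)\<close>, which leaves the error of its empirical mean after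
    subtraction of \<open>a\<close> and the linear term \<open>dev n \<omega> h\<close>.\<close>
  ultimately have "little_oP M (\<lambda>n \<omega>. dev n \<omega> (\<zeta>' (g n \<omega>)) - dev n \<omega> h
      + (LINT z|P0. \<zeta>' (g n \<omega>) z - h z)) r"
    by (rule little_oP_add)
  then have A: "little_oP M (\<lambda>n \<omega>. emp_mean n (\<lambda>i. Z i \<omega>) (\<zeta>' (g n \<omega>)) - a - dev n \<omega> h) r"
    by (rule little_oP_cong)
      (intro always_eventually allI ballI, simp add: a_def h_def \<zeta>[OF f0] int f0 g(2))
  have \<phi>: "\<phi>0 \<in> L2 P0" "(LINT z|P0. \<phi>0 z) = 0"
    using eif by (auto simp: nonparametric_efficient_influence_def L2_zero_def)
  obtain D where D: "(U has_derivative D) (at (a, b))"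
    using diff by (auto simp: differentiable_def)
  have r: "r \<longlonglongrightarrow> 0" "0 \<le> r n" for n
    using real_powr_neg_tendsto_0[of "1/2"] by (auto simp: r_def[abs_def])
  have S_bdd: "\<exists>K. holds_up_to M t (\<lambda>n \<omega>. \<bar>dev n \<omega> h\<bar> \<le> K * r n)" if "0 < t" for t
    using emp_mean_bounded_in_prob[OF h that] unfolding r_def .
  \<comment> \<open>As \<open>\<phi>0\<close> has mean zero, its empirical mean is already a centred
    deviation.\<close>
  have T_bdd: "\<exists>K. holds_up_to M t (\<lambda>n \<omega>. \<bar>emp_mean n (sample Z n \<omega>) \<phi>0\<bar> \<le> K * r n)"
    if "0 < t" for t
    using emp_mean_bounded_in_prob[OF \<phi>(1) that] unfolding r_def emp_mean_sample \<phi>(2) diff_0_right .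
  have "little_oP M (\<lambda>n \<omega>. U (emp_mean n (\<lambda>i. Z i \<omega>) (\<zeta>' (g n \<omega>)), B n \<omega>) - U (a, b)
      - D (dev n \<omega> h, emp_mean n (sample Z n \<omega>) \<phi>0)) r"
    by (rule little_oP_delta_method[OF D A B S_bdd T_bdd r])
  then show ?thesis
    unfolding r_def[symmetric]
  proof (rule little_oP_cong, use eventually_gt_at_top[of "0::nat"] in eventually_elim)
    case (elim n)
    show ?case
      unfolding emp_mean_influence[OF elim] has_derivative_real_pair_partials[OF D]
      by (simp add: est_predictiveness_def predictiveness_def emp_mean_sample a_def b_def h_def
          g_def B_def)
  qed
qed

section \<open>Transfer to data-dependent selections and rankings\<close>

theorem theorem2:
  fixes \<X> :: "(real ^ 'p) set" and \<Y> :: "real set"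
    and \<M> :: "((real ^ 'p) \<times> real) measure set" and P0 :: "((real ^ 'p) \<times> real) measure"
    and \<F> :: "(real ^ 'p \<Rightarrow> real) set" and N :: "(real ^ 'p \<Rightarrow> real) \<Rightarrow> real"
    and U :: "real \<times> real \<Rightarrow> real"
    and \<zeta> :: "(real ^ 'p \<Rightarrow> real) \<Rightarrow> ((real ^ 'p) \<times> real) measure \<Rightarrow> real"
    and \<eta> :: "((real ^ 'p) \<times> real) measure \<Rightarrow> real"
    and \<zeta>' :: "(real ^ 'p \<Rightarrow> real) \<Rightarrow> (real ^ 'p) \<times> real \<Rightarrow> real"
    and \<phi>0 :: "(real ^ 'p) \<times> real \<Rightarrow> real"
    and f0 :: "'p set \<Rightarrow> real ^ 'p \<Rightarrow> real"
    and M :: "'w measure" and Z :: "nat \<Rightarrow> 'w \<Rightarrow> (real ^ 'p) \<times> real"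
    and fn :: "nat \<Rightarrow> 'p set \<Rightarrow> (nat \<Rightarrow> (real ^ 'p) \<times> real) \<Rightarrow> real ^ 'p \<Rightarrow> real"
    and \<eta>n :: "nat \<Rightarrow> (nat \<Rightarrow> (real ^ 'p) \<times> real) \<Rightarrow> real"
  assumes model: "statistical_model \<X> \<Y> \<M>" "P0 \<in> \<M>"
    and iid: "prob_space M" "prob_space.indep_vars M (\<lambda>_. P0) Z UNIV"
      "\<forall>i. distr M P0 (Z i) = P0"
    and function_class: "normed_function_class \<X> \<F> N"
    and metric: "predictiveness_metric \<F> \<M> U \<zeta> \<eta>"
    and maximizers:
      "\<forall>S. is_arg_max (\<lambda>f. predictiveness U \<zeta> \<eta> f P0) (\<lambda>f. f \<in> excluding \<X> \<F> S) (f0 S)"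
    and estimators:
      "\<forall>n S. \<forall>d\<in>space (PiM {..<n} (\<lambda>_. P0)). fn n S d \<in> excluding \<X> \<F> S"
  shows
    "(\<forall>Sn \<S>0.
        selection_algorithm P0 Sn \<and> stable_selection M Z f0 Sn \<S>0 \<and>
        (\<forall>S\<in>\<S>0. regularity_conditions \<X> \<M> P0 \<F> N U \<zeta> \<eta> \<zeta>' \<phi>0 f0 M Z fn \<eta>n S) \<longrightarrow>
        (\<forall>S\<in>\<S>0. little_oP M
           (\<lambda>n \<omega>. let d = sample Z n \<omega> in
              est_predictiveness U \<zeta>' fn \<eta>n n (Sn n d) d
              - predictiveness U \<zeta> \<eta> (f0 S) P0
              - emp_mean n d (influence U \<zeta> \<eta> \<zeta>' \<phi>0 P0 (f0 S)))
           (\<lambda>n. real n powr (-1/2)))) \<and>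
     (\<forall>Rn \<R>0.
        ranking_algorithm P0 Rn \<and> stable_ranking M Z f0 Rn \<R>0 \<and>
        (\<forall>R\<in>\<R>0. \<forall>j\<in>{1..CARD('p)}.
           regularity_conditions \<X> \<M> P0 \<F> N U \<zeta> \<eta> \<zeta>' \<phi>0 f0 M Z fn \<eta>n (set (take j R))) \<longrightarrow>
        (\<forall>R\<in>\<R>0. \<forall>j\<in>{1..CARD('p)}. little_oP M
           (\<lambda>n \<omega>. let d = sample Z n \<omega> in
              est_predictiveness U \<zeta>' fn \<eta>n n (set (take j (Rn n d))) d
              - predictiveness U \<zeta> \<eta> (f0 (set (take j R))) P0
              - emp_mean n d (influence U \<zeta> \<eta> \<zeta>' \<phi>0 P0 (f0 (set (take j R)))))
           (\<lambda>n. real n powr (-1/2))))"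
proof -
  have sample: "iid_sample M P0 Z"
    using iid by (simp add: iid_sample_def iid_sample_axioms_def)
  interpret iid_sample M P0 Z by (rule sample)
  have "f0 S \<in> excluding \<X> \<F> S" for S
    using maximizers by (simp add: is_arg_max_def)
  then have f0: "f0 S \<in> \<F>" for S unfolding excluding_def by blast
  \<comment> \<open>The centring uses a common \<open>f\<close> in place of \<open>f0 S\<close>, so
    all sets sharing the maximizer \<open>f\<close> have literally the same expansion, as the
    random-index argument requires.\<close>
  have fixed: "little_oP M (\<lambda>n \<omega>. est_predictiveness U \<zeta>' fn \<eta>n n S (sample Z n \<omega>)
      - predictiveness U \<zeta> \<eta> f P0 - emp_mean n (sample Z n \<omega>) (influence U \<zeta> \<eta> \<zeta>' \<phi>0 P0 f))
      (\<lambda>n. real n powr (-1/2))"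
    if "regularity_conditions \<X> \<M> P0 \<F> N U \<zeta> \<eta> \<zeta>' \<phi>0 f0 M Z fn \<eta>n S" "f0 S = f" for S f
    using est_predictiveness_expansion[where ?f0.0 = f0 and fn = fn and S = S,
        OF sample model(2) f0 estimators[rule_format] that(1)]
    unfolding that(2) .
  show ?thesis
    unfolding Let_def
  proof (intro conjI allI impI ballI)
    fix Sn \<S>0 S
    assume H: "selection_algorithm P0 Sn \<and> stable_selection M Z f0 Sn \<S>0 \<and>
        (\<forall>S\<in>\<S>0. regularity_conditions \<X> \<M> P0 \<F> N U \<zeta> \<eta> \<zeta>' \<phi>0 f0 M Z fn \<eta>n S)"
      and S: "S \<in> \<S>0"
    then have lim: "(\<lambda>n. prob {\<omega> \<in> space M. Sn n (sample Z n \<omega>) \<in> \<S>0}) \<longlonglongrightarrow> 1"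
      and same: "\<And>S'. S' \<in> \<S>0 \<Longrightarrow> f0 S' = f0 S"
      unfolding stable_selection_def by blast+
    show "little_oP M (\<lambda>n \<omega>.
        est_predictiveness U \<zeta>' fn \<eta>n n (Sn n (sample Z n \<omega>)) (sample Z n \<omega>)
        - predictiveness U \<zeta> \<eta> (f0 S) P0
        - emp_mean n (sample Z n \<omega>) (influence U \<zeta> \<eta> \<zeta>' \<phi>0 P0 (f0 S)))
        (\<lambda>n. real n powr (-1/2))"
      \<comment> \<open>Finiteness of \<S>0 comes from the finite type of covariate indices.\<close>
      by (rule little_oP_random_index[where I = \<S>0 and L = "\<lambda>n \<omega>. Sn n (sample Z n \<omega>)",
            OF finite holds_up_to_if_measure_tendsto_1[OF lim]])
        (use H same in \<open>blast intro: fixed\<close>)+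
  next
    fix Rn \<R>0 R j
    assume H: "ranking_algorithm P0 Rn \<and> stable_ranking M Z f0 Rn \<R>0 \<and>
        (\<forall>R\<in>\<R>0. \<forall>j\<in>{1..CARD('p)}. regularity_conditions \<X> \<M> P0 \<F> N U \<zeta> \<eta> \<zeta>' \<phi>0 f0 M Z fn \<eta>n
           (set (take j R)))"
      and R: "R \<in> \<R>0" and j: "j \<in> {1..CARD('p)}"
    then have lim: "(\<lambda>n. prob {\<omega> \<in> space M. Rn n (sample Z n \<omega>) \<in> \<R>0}) \<longlonglongrightarrow> 1"
      and same: "\<And>R'. R' \<in> \<R>0 \<Longrightarrow> f0 (set (take j R')) = f0 (set (take j R))"
      and subset: "\<R>0 \<subseteq> permutations_of_set UNIV"
      unfolding stable_ranking_def by blast+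
    \<comment> \<open>Lists over a nonempty finite type form an infinite type, so finiteness comes
      from \<R>0 consisting of permutations.\<close>
    have finite: "finite \<R>0"
      by (rule finite_subset[OF subset]) simp
    show "little_oP M (\<lambda>n \<omega>.
        est_predictiveness U \<zeta>' fn \<eta>n n (set (take j (Rn n (sample Z n \<omega>)))) (sample Z n \<omega>)
        - predictiveness U \<zeta> \<eta> (f0 (set (take j R))) P0
        - emp_mean n (sample Z n \<omega>) (influence U \<zeta> \<eta> \<zeta>' \<phi>0 P0 (f0 (set (take j R)))))
        (\<lambda>n. real n powr (-1/2))"
      by (rule little_oP_random_index[where I = \<R>0 and L = "\<lambda>n \<omega>. Rn n (sample Z n \<omega>)",
            OF finite holds_up_to_if_measure_tendsto_1[OF lim]])
        (use H same j in \<open>blast intro: fixed\<close>)+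
  qed
qed

end
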